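(* Let $n\ge 2$. For every Schur-positive set $A\subseteq\mathfrak{S}_{n-1}$, the set $AC_n=\{\sigma c:\ \sigma\in A,\ c\in C_n\}\subseteq\mathfrak{S}_n$ is cyclic Schur-positive.
   Context: Permutations are written in one-line notation and composed right to left, $(\sigma\tau)(i)=\sigma(\tau(i))$. For $\pi\in\mathfrak{S}_n$, $\mathrm{Des}(\pi)=\{i\in[n-1]:\pi(i)>\pi(i+1)\}$ and the cyclic descent set is $\mathrm{cDes}(\pi)=\{i\in[n]:\pi(i)>\pi(i+1)\}$ with the convention $\pi(n+1):=\pi(1)$. For $J\subseteq[n]$ write $\mathbf{x}^J=\prod_{i\in J}x_i$, and for an integer $i$ let $i+J=\{i+j \bmod n: j\in J\}\subseteq[n]$ (residues in $[n]$). Let $c_n=(1,2,\dots,n)=23\cdots n1$ and $C_n=\langle c_n\rangle$; $\mathfrak{S}_{n-1}$ is identified with the permutations in $\mathfrak{S}_n$ fixing $n$. Schur-positivity: for $D\subseteq[n-1]$ let $\mathcal{F}_{n,D}=\sum x_{i_1}\cdots x_{i_n}$, summed over $i_1\le\cdots\le i_n$ with $i_j<i_{j+1}$ whenever $j\in D$ (Gessel's fundamental quasisymmetric function). A set $A\subseteq\mathfrak{S}_m$ is Schur-positive if $\sum_{\pi\in A}\mathcal{F}_{m,\mathrm{Des}(\pi)}$ is symmetric and has nonnegative coefficients in the Schur basis. Cyclic Schur-positivity: for a skew shape $\lambda/\mu$ with $n$ cells (English notation), the descent set of a standard Young tableau $T$ is the set of $i\in[n-1]$ such that $i+1$ lies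 in a strictly lower row than $i$. A cyclic descent extension on $\mathrm{SYT}(\lambda/\mu)$ is a pair $(\mathrm{cDes},\psi)$, where $\mathrm{cDes}:\mathrm{SYT}(\lambda/\mu)\to 2^{[n]}$ and $\psi$ is a bijection of $\mathrm{SYT}(\lambda/\mu)$, such that for all $T$: $\mathrm{cDes}(T)\cap[n-1]=\mathrm{Des}(T)$, $\mathrm{cDes}(\psi T)=1+\mathrm{cDes}(T)$, and $\emptyset\ne\mathrm{cDes}(T)\ne[n]$. Such an extension exists if and only if $\lambda/\mu$ is not a connected ribbon, and then $\sum_{T\in\mathrm{SYT}(\lambda/\mu)}\mathbf{x}^{\mathrm{cDes}(T)}$ does not depend on the choice of extension. A set $A\subseteq\mathfrak{S}_n$ is cyclic Schur-positive (cSp) if there are nonnegative integers $m_{\lambda/\mu}$, indexed by skew shapes with $n$ cells that are not connected ribbons, such that $\sum_{\pi\in A}\mathbf{x}^{\mathrm{cDes}(\pi)}=\sum_{\lambda/\mu}m_{\lambda/\mu}\sum_{T\in\mathrm{SYT}(\lambda/\mu)}\mathbf{x}^{\mathrm{cDes}(T)}$. *)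

theory Defs
  imports Complex_Main "HOL-Combinatorics.Permutations"
begin

section \<open>Permutations, descents, cyclic descents\<close>

text \<open>Permutations of [n] are functions nat => nat permuting {1..n}; composition
  right to left is function composition.\<close>

definition des :: "nat \<Rightarrow> (nat \<Rightarrow> nat) \<Rightarrow> nat set" where
  "des n p = {i \<in> {1..n-1}. p i > p (i+1)}"

definition cdes :: "nat \<Rightarrow> (nat \<Rightarrow> nat) \<Rightarrow> nat set" where
  "cdes n p = {i \<in> {1..n}. p i > p (if i = n then 1 else i+1)}"

text \<open>The long cycle c_n = (1,2,...,n) and the cyclic group C_n it generates.\<close>

definition cyc :: "nat \<Rightarrow> nat \<Rightarrow> nat" where
  "cyc n i = (if 1 \<le> i \<and> i < n then i+1 else if i = n then 1 else i)"

definition cyclic_group :: "nat \<Rightarrow> (nat \<Rightarrow> nat) set" where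
  "cyclic_group n = {cyc n ^^ k | k. True}"

text \<open>1 + J for J a subset of [n] (residues taken in [n]).\<close>

definition shift1 :: "nat \<Rightarrow> nat set \<Rightarrow> nat set" where
  "shift1 n J = (\<lambda>j. j mod n + 1) ` J"

section \<open>Formal power series in countably many variables x_0, x_1, ...\<close>

text \<open>A formal power series is represented by its coefficient function on
  exponent vectors alpha :: nat => nat (monomial prod_k x_k^(alpha k)).\<close>

type_synonym fps_inf = "(nat \<Rightarrow> nat) \<Rightarrow> real"

text \<open>Gessel's fundamental quasisymmetric function F_{m,D}: the coefficient of
  x^alpha is the number of weakly increasing index words i_1..i_m, strict at
  positions in D, whose content is alpha.\<close>

definition fundamental :: "nat \<Rightarrow> nat set \<Rightarrow> fps_inf" where
  "fundamental m D alpha = real (card {w :: nat list. length w = m \<and> sorted w \<and>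
      (\<forall>j\<in>D. 1 \<le> j \<and> j < m \<longrightarrow> w ! (j-1) < w ! j) \<and>
      (\<forall>k. count_list w k = alpha k)})"

definition symmetric_fps :: "fps_inf \<Rightarrow> bool" where
  "symmetric_fps f \<longleftrightarrow> (\<forall>p alpha. bij p \<longrightarrow> f (alpha \<circ> p) = f alpha)"

section \<open>Partitions, skew shapes, tableaux (English notation, 0-indexed rows/columns)\<close>

definition is_partition :: "nat list \<Rightarrow> bool" where
  "is_partition lam \<longleftrightarrow> sorted_wrt (\<ge>) lam \<and> (\<forall>x\<in>set lam. 0 < x)"

definition part :: "nat list \<Rightarrow> nat \<Rightarrow> nat" where
  "part mu r = (if r < length mu then mu ! r else 0)"

definition skew_shape :: "nat list \<Rightarrow> nat list \<Rightarrow> bool" where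
  "skew_shape lam mu \<longleftrightarrow> is_partition lam \<and> is_partition mu \<and>
     length mu \<le> length lam \<and> (\<forall>i<length mu. mu ! i \<le> lam ! i)"

text \<open>Cells (row, column) of lam/mu; row index grows downwards.\<close>

definition cells :: "nat list \<Rightarrow> nat list \<Rightarrow> (nat \<times> nat) set" where
  "cells lam mu = {(r, c). r < length lam \<and> part mu r \<le> c \<and> c < lam ! r}"

text \<open>Semistandard Young tableaux of shape lam/mu with content alpha.\<close>

definition ssyt :: "nat list \<Rightarrow> nat list \<Rightarrow> (nat \<Rightarrow> nat) \<Rightarrow> ((nat \<times> nat) \<Rightarrow> nat) set" where
  "ssyt lam mu alpha = {T. (\<forall>x. x \<notin> cells lam mu \<longrightarrow> T x = 0) \<and>
     (\<forall>r c. (r, c) \<in> cells lam mu \<and> (r, c+1) \<in> cells lam mu \<longrightarrow> T (r, c) \<le> T (r, c+1)) \<and>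
     (\<forall>r c. (r, c) \<in> cells lam mu \<and> (r+1, c) \<in> cells lam mu \<longrightarrow> T (r, c) < T (r+1, c)) \<and>
     (\<forall>k. card {x \<in> cells lam mu. T x = k} = alpha k)}"

text \<open>Schur function s_lam (combinatorial definition via SSYT).\<close>

definition schur :: "nat list \<Rightarrow> fps_inf" where
  "schur lam alpha = real (card (ssyt lam [] alpha))"

definition partitions_of :: "nat \<Rightarrow> nat list set" where
  "partitions_of m = {lam. is_partition lam \<and> sum_list lam = m}"

text \<open>Schur-positivity of a set A of permutations of [m].\<close>

definition schur_positive :: "nat \<Rightarrow> (nat \<Rightarrow> nat) set \<Rightarrow> bool" where
  "schur_positive m A \<longleftrightarrow>
     (let Q = (\<lambda>alpha. \<Sum>p\<in>A. fundamental m (des m p) alpha) in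
      symmetric_fps Q \<and>
      (\<exists>c :: nat list \<Rightarrow> real. (\<forall>lam. 0 \<le> c lam) \<and>
          Q = (\<lambda>alpha. \<Sum>lam\<in>partitions_of m. c lam * schur lam alpha)))"

text \<open>Standard Young tableaux of shape lam/mu and their descent sets.\<close>

definition syt :: "nat list \<Rightarrow> nat list \<Rightarrow> ((nat \<times> nat) \<Rightarrow> nat) set" where
  "syt lam mu = {T. (\<forall>x. x \<notin> cells lam mu \<longrightarrow> T x = 0) \<and>
     bij_betw T (cells lam mu) {1..card (cells lam mu)} \<and>
     (\<forall>r c. (r, c) \<in> cells lam mu \<and> (r, c+1) \<in> cells lam mu \<longrightarrow> T (r, c) < T (r, c+1)) \<and>
     (\<forall>r c. (r, c) \<in> cells lam mu \<and> (r+1, c) \<in> cells lam mu \<longrightarrow> T (r, c) < T (r+1, c))}"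

definition syt_des :: "nat list \<Rightarrow> nat list \<Rightarrow> ((nat \<times> nat) \<Rightarrow> nat) \<Rightarrow> nat set" where
  "syt_des lam mu T = {i \<in> {1..card (cells lam mu) - 1}. \<exists>x y. x \<in> cells lam mu \<and> y \<in> cells lam mu \<and>
      T x = i \<and> T y = i + 1 \<and> fst x < fst y}"

text \<open>Connected ribbons: edge-connected skew shapes containing no 2x2 square.\<close>

definition cell_adj :: "(nat \<times> nat) set \<Rightarrow> ((nat \<times> nat) \<times> (nat \<times> nat)) set" where
  "cell_adj C = {((r, c), (r', c')). (r, c) \<in> C \<and> (r', c') \<in> C \<and>
      ((r = r' \<and> (c' = c + 1 \<or> c = c' + 1)) \<or> (c = c' \<and> (r' = r + 1 \<or> r = r' + 1)))}"

definition connected_ribbon :: "nat list \<Rightarrow> nat list \<Rightarrow> bool" where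
  "connected_ribbon lam mu \<longleftrightarrow>
     (let C = cells lam mu in
       (\<forall>x\<in>C. \<forall>y\<in>C. (x, y) \<in> (cell_adj C)\<^sup>*) \<and>
       \<not> (\<exists>r c. (r, c) \<in> C \<and> (r+1, c) \<in> C \<and> (r, c+1) \<in> C \<and> (r+1, c+1) \<in> C))"

text \<open>Cyclic descent extension (cDes, psi) on SYT(lam/mu).\<close>

definition cyclic_descent_ext :: "nat list \<Rightarrow> nat list \<Rightarrow>
    (((nat \<times> nat) \<Rightarrow> nat) \<Rightarrow> nat set) \<Rightarrow> (((nat \<times> nat) \<Rightarrow> nat) \<Rightarrow> ((nat \<times> nat) \<Rightarrow> nat)) \<Rightarrow> bool" where
  "cyclic_descent_ext lam mu cD psi \<longleftrightarrow>
     (let n = card (cells lam mu) in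
       bij_betw psi (syt lam mu) (syt lam mu) \<and>
       (\<forall>T\<in>syt lam mu.
          cD T \<subseteq> {1..n} \<and>
          cD T \<inter> {1..n-1} = syt_des lam mu T \<and>
          cD (psi T) = shift1 n (cD T) \<and>
          cD T \<noteq> {} \<and> cD T \<noteq> {1..n}))"

text \<open>Cyclic Schur-positivity. Since the polynomials x^J (J subset of [n]) are
  distinct squarefree monomials, equality of the generating polynomials is
  equality of the coefficient of every x^J. Skew shapes are indexed by pairs
  (lam, mu); for each shape used, a cyclic descent extension is chosen (the
  resulting sum is independent of this choice).\<close>

definition cyclic_schur_positive :: "nat \<Rightarrow> (nat \<Rightarrow> nat) set \<Rightarrow> bool" where
  "cyclic_schur_positive n A \<longleftrightarrow>
     (\<exists>(m :: nat list \<times> nat list \<Rightarrow> nat)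
        (cD :: nat list \<times> nat list \<Rightarrow> ((nat \<times> nat) \<Rightarrow> nat) \<Rightarrow> nat set).
        finite {s. m s \<noteq> 0} \<and>
        (\<forall>s. m s \<noteq> 0 \<longrightarrow>
             skew_shape (fst s) (snd s) \<and> card (cells (fst s) (snd s)) = n \<and>
             \<not> connected_ribbon (fst s) (snd s) \<and>
             (\<exists>psi. cyclic_descent_ext (fst s) (snd s) (cD s) psi)) \<and>
        (\<forall>J. card {p \<in> A. cdes n p = J} =
             (\<Sum>s\<in>{s. m s \<noteq> 0}. m s * card {T \<in> syt (fst s) (snd s). cD s T = J})))"

end

theory Submission
  imports Defs "HOL-Library.Infinite_Set" "HOL-Library.Product_Lexorder" "HOL-Combinatorics.Cycles"
begin

text \<open>For \<open>\<sigma> \<in> A\<close>, extended by \<open>\<sigma>(n) = n\<close>, the cyclic descent sets of the permutations \<open>\<sigma>c\<close> are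
  the rotations of \<open>Des \<sigma> \<union> {n}\<close>. The descent sets of \<open>A\<close> are distributed like those of standard
  tableaux of partition shapes, with integral multiplicities because the Kostka matrix is
  unitriangular. So for each \<open>\<lambda>\<close> the rotations of the sets \<open>Des S \<union> {n}\<close>, \<open>S \<in> SYT(\<lambda>)\<close>, have to be
  realized as cyclic descent sets on a single shape; this shape is \<open>\<lambda>\<close> with a disconnected cell
  added. A cyclic descent extension with this distribution exists as soon as the rotations,
  restricted to \<open>[n - 1]\<close>, are distributed like the ordinary descent sets, for then any
  descent-preserving bijection transports the rotation.

  By standardization, the tableaux with descents in \<open>E\<close> are counted by the Kostka number whose
  content consists of the sizes of the blocks into which \<open>E \<union> {n}\<close> divides \<open>[n]\<close>. As the entry of
  the new cell is arbitrary, the Kostka number of the enlarged shape is the sum over all blocks of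
  the Kostka numbers of \<open>\<lambda>\<close> with that block shortened by one. The rotations taking \<open>n\<close> to
  \<open>k \<in> E \<union> {n}\<close> contribute the Kostka number for the block ending at \<open>k\<close>, but with the blocks in
  cyclically permuted order, so the two counts agree by the symmetry of Schur functions.\<close>

section \<open>Distributions of statistics\<close>

definition distribution :: "('a \<Rightarrow> 'b) \<Rightarrow> 'a set \<Rightarrow> 'b multiset" where
  "distribution f X = image_mset f (mset_set X)"

lemma distribution_eq_sum: "distribution f X = (\<Sum>x\<in>X. {#f x#})"
  by (induction X rule: infinite_finite_induct) (auto simp: distribution_def)

lemma set_mset_distribution: "finite X \<Longrightarrow> set_mset (distribution f X) = f ` X"
  by (simp add: distribution_def)

lemma count_distribution: "finite X \<Longrightarrow> count (distribution f X) y = card {x \<in> X. f x = y}"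
  by (simp add: distribution_def count_image_mset_eq_card_vimage)

lemma size_filter_distribution:
  "finite X \<Longrightarrow> size (filter_mset P (distribution f X)) = card {x \<in> X. P (f x)}"
  by (simp add: distribution_def filter_mset_image_mset)

lemma distribution_cong:
  "(\<And>x. x \<in> X \<Longrightarrow> f x = g x) \<Longrightarrow> distribution f X = distribution g X"
  unfolding distribution_eq_sum by (simp cong: sum.cong)

lemma distribution_comp_bij_betw:
  "bij_betw b Y X \<Longrightarrow> distribution (\<lambda>y. f (b y)) Y = distribution f X"
  unfolding distribution_eq_sum by (rule sum.reindex_bij_betw)

lemma image_mset_distribution: "image_mset h (distribution f X) = distribution (\<lambda>x. h (f x)) X"
  by (simp add: distribution_def image_mset.compositionality comp_def)

lemma distribution_Times:
  "distribution (\<lambda>(x, k). h k (f x)) (X \<times> K) = (\<Sum>k\<in>K. image_mset (h k) (distribution f X))"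
  unfolding image_mset_distribution
  unfolding distribution_eq_sum
  by (subst sum.swap) (simp add: sum.cartesian_product case_prod_unfold)

lemma distribution_eq_obtain_bij_betw:
  assumes "finite X" "finite Y" "distribution g X = distribution h Y"
  obtains b where "bij_betw b Y X" "\<And>y. y \<in> Y \<Longrightarrow> g (b y) = h y"
proof -
  have "card Y = card X"
    using arg_cong[OF assms(3), of size] by (simp add: distribution_def)
  then obtain a where a: "bij_betw a Y X"
    using finite_same_card_bij assms(1,2) by blast
  have "image_mset h (mset_set Y) = image_mset (\<lambda>y. g (a y)) (mset_set Y)"
    using distribution_comp_bij_betw[OF a, of g] assms(3) by (simp add: distribution_def)
  then obtain p where p: "p permutes Y" and h_eq: "\<forall>y\<in>Y. h y = g (a (p y))"
    by (rule image_mset_eq_implies_permutes[OF assms(2)])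
  have "bij_betw (a \<circ> p) Y X"
    using permutes_imp_bij[OF p] a by (rule bij_betw_trans)
  then show thesis by (rule that) (simp add: h_eq)
qed

lemma distribution_eq_imp_sum_eq:
  assumes "distribution f X = distribution g Y"
  shows "sum f X = sum g Y"
  using assms by (simp add: sum_unfold_sum_mset distribution_def)

lemma size_filter_sum_mset:
  "size {#x \<in># \<Sum>i\<in>I. M i. P x#} = (\<Sum>i\<in>I. size {#x \<in># M i. P x#})"
  by (induction I rule: infinite_finite_induct) auto

lemma filter_repeat_mset: "{#x \<in># repeat_mset k M. P x#} = repeat_mset k {#x \<in># M. P x#}"
  by (simp add: multiset_eq_iff)

lemma multiset_eqI_size_subsets:
  fixes M N :: "'a set multiset"
  assumes U: "finite U" and M: "\<And>D. D \<in># M \<Longrightarrow> D \<subseteq> U" and N: "\<And>D. D \<in># N \<Longrightarrow> D \<subseteq> U"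
    and size: "\<And>E. E \<subseteq> U \<Longrightarrow> size {#D \<in># M. D \<subseteq> E#} = size {#D \<in># N. D \<subseteq> E#}"
  shows "M = N"
proof (rule multiset_eqI)
  fix E
  have split: "size {#D \<in># L. D \<subseteq> E#} = count L E + size {#D \<in># L. D \<subset> E#}"
    for L :: "'a set multiset" and E
  proof -
    have "{#D \<in># L. D \<subseteq> E#} = {#D \<in># L. D = E#} + {#D \<in># L. D \<subset> E#}"
      by (auto simp: multiset_eq_iff)
    then show ?thesis by (simp add: filter_eq_replicate_mset)
  qed
  show "count M E = count N E"
  proof (cases "E \<subseteq> U")
    case True
    then have "finite E" using U by (rule finite_subset)
    then show ?thesis using True
    proof (induction E rule: finite_psubset_induct)
      case (psubset E)
      have "{#D \<in># M. D \<subset> E#} = {#D \<in># N. D \<subset> E#}"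
        using psubset by (auto simp: multiset_eq_iff)
      then show ?case using size[OF psubset.prems] by (simp add: split)
    qed
  next
    case False
    then show ?thesis using M N by (metis count_inI)
  qed
qed

section \<open>Semistandard tableaux of skew shape\<close>

lemma mem_cells_iff: "(r, c) \<in> cells lam mu \<longleftrightarrow> part mu r \<le> c \<and> c < part lam r"
  by (auto simp: cells_def part_def)

lemma finite_cells [simp]: "finite (cells lam mu)"
proof (rule finite_subset)
  show "cells lam mu \<subseteq> (SIGMA r:{..<length lam}. {..<lam ! r})"
    by (auto simp: cells_def)
qed auto

lemma part_antimono:
  assumes "is_partition lam" "r \<le> s"
  shows "part lam s \<le> part lam r"
proof (cases "r = s")
  case False
  then show ?thesis
    using assms sorted_wrt_nth_less[of "(\<ge>)" lam r s] by (auto simp: part_def is_partition_def)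
qed simp

lemma skew_shape_iff:
  "skew_shape lam mu \<longleftrightarrow> is_partition lam \<and> is_partition mu \<and> (\<forall>r. part mu r \<le> part lam r)"
proof -
  have "(length mu \<le> length lam \<and> (\<forall>i<length mu. mu ! i \<le> lam ! i)) \<longleftrightarrow>
      (\<forall>r. part mu r \<le> part lam r)" if "is_partition mu"
  proof
    assume parts: "\<forall>r. part mu r \<le> part lam r"
    have "r < length lam \<and> mu ! r \<le> lam ! r" if r: "r < length mu" for r
    proof -
      have "0 < mu ! r" using r \<open>is_partition mu\<close> by (simp add: is_partition_def)
      then show ?thesis using parts[rule_format, of r] r by (auto simp: part_def split: if_splits)
    qed
    then show "length mu \<le> length lam \<and> (\<forall>i<length mu. mu ! i \<le> lam ! i)"
      by (meson linorder_not_le order_refl)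
  qed (auto simp: part_def)
  then show ?thesis by (auto simp: skew_shape_def)
qed

lemma cells_convex:
  assumes "skew_shape lam mu" "(r1, c1) \<in> cells lam mu" "(r2, c2) \<in> cells lam mu"
    and "r1 \<le> r" "r \<le> r2" "c1 \<le> c" "c \<le> c2"
  shows "(r, c) \<in> cells lam mu"
  using assms part_antimono[of mu r1 r] part_antimono[of lam r r2]
  by (auto simp: mem_cells_iff skew_shape_iff)

definition semistandard :: "nat list \<Rightarrow> nat list \<Rightarrow> (nat \<times> nat \<Rightarrow> nat) \<Rightarrow> bool" where
  "semistandard lam mu T \<longleftrightarrow> (\<forall>x. x \<notin> cells lam mu \<longrightarrow> T x = 0) \<and>
     (\<forall>r c. (r, c) \<in> cells lam mu \<and> (r, c+1) \<in> cells lam mu \<longrightarrow> T (r, c) \<le> T (r, c+1)) \<and>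
     (\<forall>r c. (r, c) \<in> cells lam mu \<and> (r+1, c) \<in> cells lam mu \<longrightarrow> T (r, c) < T (r+1, c))"

lemma ssyt_iff:
  "T \<in> ssyt lam mu alpha \<longleftrightarrow>
     semistandard lam mu T \<and> count (distribution T (cells lam mu)) = alpha"
  by (auto simp: ssyt_def semistandard_def count_distribution fun_eq_iff)

lemma syt_iff:
  "T \<in> syt lam mu \<longleftrightarrow>
     semistandard lam mu T \<and> bij_betw T (cells lam mu) {1..card (cells lam mu)}"
proof
  assume T: "semistandard lam mu T \<and> bij_betw T (cells lam mu) {1..card (cells lam mu)}"
  have "T (r, c) \<noteq> T (r, c+1)" if "(r, c) \<in> cells lam mu" "(r, c+1) \<in> cells lam mu" for r c
    using T inj_onD[of T "cells lam mu" "(r, c)" "(r, c+1)"] that by (auto simp: bij_betw_def)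
  with T show "T \<in> syt lam mu"
    unfolding syt_def semistandard_def by (simp add: le_neq_implies_less)
qed (auto simp: syt_def semistandard_def less_imp_le)

lemma finite_syt [simp]: "finite (syt lam mu)"
proof (rule finite_subset)
  show "syt lam mu \<subseteq> {T. \<forall>x. (x \<in> cells lam mu \<longrightarrow> T x \<in> {1..card (cells lam mu)}) \<and>
      (x \<notin> cells lam mu \<longrightarrow> T x = 0)}"
    by (auto simp: syt_def dest: bij_betwE)
qed (intro finite_set_of_finite_funs finite_cells finite_atLeastAtMost)

lemma semistandard_row:
  assumes "skew_shape lam mu" "semistandard lam mu T"
    and "(r, c) \<in> cells lam mu" "(r, c') \<in> cells lam mu" "c \<le> c'"
  shows "T (r, c) \<le> T (r, c')"
  using assms(5,4)
proof (induction c' rule: dec_induct)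
  case (step d)
  have "(r, d) \<in> cells lam mu"
    using step by (intro cells_convex[OF assms(1,3) step.prems]) auto
  with step assms(2) show ?case by (fastforce simp: semistandard_def)
qed simp

lemma semistandard_column:
  assumes "skew_shape lam mu" "semistandard lam mu T"
    and "(r, c) \<in> cells lam mu" "(r', c) \<in> cells lam mu" "r < r'"
  shows "T (r, c) < T (r', c)"
  using Suc_leI[OF assms(5)] assms(4)
proof (induction r' rule: dec_induct)
  case base
  then show ?case using assms(2,3) by (simp add: semistandard_def)
next
  case (step s)
  have "(s, c) \<in> cells lam mu"
    using step by (intro cells_convex[OF assms(1,3) step.prems]) auto
  then have "T (r, c) < T (s, c)" "T (s, c) < T (Suc s, c)"
    using step assms(2) by (auto simp: semistandard_def)
  then show ?case by simp
qed

lemma semistandard_less: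
  assumes "skew_shape lam mu" "semistandard lam mu T"
    and "(r, c) \<in> cells lam mu" "(r', c') \<in> cells lam mu" "r < r'" "c \<le> c'"
  shows "T (r, c) < T (r', c')"
proof -
  have corner: "(r', c) \<in> cells lam mu"
    using assms(5,6) by (intro cells_convex[OF assms(1,3,4)]) auto
  have "T (r, c) < T (r', c)"
    using semistandard_column[OF assms(1,2,3) corner assms(5)] .
  also have "\<dots> \<le> T (r', c')"
    using semistandard_row[OF assms(1,2) corner assms(4,6)] .
  finally show ?thesis .
qed

lemma semistandard_le:
  assumes "skew_shape lam mu" "semistandard lam mu T"
    and "(r, c) \<in> cells lam mu" "(r', c') \<in> cells lam mu" "r \<le> r'" "c \<le> c'"
  shows "T (r, c) \<le> T (r', c')"
  using semistandard_less[OF assms(1-4)] semistandard_row[OF assms(1-3), of c'] assms(4-6)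
  by (cases "r = r'") (auto intro: less_imp_le)

section \<open>Standardization\<close>

definition ascents :: "(nat \<Rightarrow> nat) \<Rightarrow> nat set" where
  "ascents f = {i. f i < f (Suc i)}"

definition kostka :: "nat list \<Rightarrow> nat list \<Rightarrow> nat multiset \<Rightarrow> nat" where
  "kostka lam mu M = card (ssyt lam mu (count M))"

lemma sorted_map_upt:
  fixes f :: "nat \<Rightarrow> 'a::linorder"
  shows "mono_on {a..b} f \<Longrightarrow> sorted (map f [a..<Suc b])"
  unfolding sorted_map by (rule sorted_wrt_mono_rel[OF _ sorted_upt]) (auto intro: mono_onD)

lemma mset_map_upt: "mset (map f [a..<Suc b]) = distribution f {a..b}"
  by (simp add: distribution_def atLeastLessThanSuc_atLeastAtMost del: upt_Suc flip: mset_set_set)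

lemma mono_on_distribution_unique:
  fixes f g :: "nat \<Rightarrow> 'a::linorder"
  assumes "mono_on {a..b} f" "mono_on {a..b} g" "distribution f {a..b} = distribution g {a..b}"
    and "i \<in> {a..b}"
  shows "f i = g i"
proof -
  have "map f [a..<Suc b] = map g [a..<Suc b]"
    using sorted_map_upt[OF assms(1)] sorted_map_upt[OF assms(2)] assms(3)
    by (metis mset_map_upt properties_for_sort sorted_sort_id)
  then show ?thesis using assms(4) by (simp del: upt_Suc)
qed

lemma ex_bij_betw_rank:
  fixes key :: "'a \<Rightarrow> 'b::wellorder"
  assumes fin: "finite C" and inj: "inj_on key C"
  shows "\<exists>S. bij_betw S C {1..card C} \<and> (\<forall>x\<in>C. \<forall>y\<in>C. S x < S y \<longleftrightarrow> key x < key y)"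
proof -
  have card: "card (key ` C) = card C" using inj by (rule card_image)
  obtain h where h: "bij_betw h {..<card C} (key ` C)" "strict_mono_on {..<card C} h"
    using ex_bij_betw_strict_mono_card[of "key ` C"] fin by (auto simp: card)
  let ?rank = "\<lambda>x. inv_into {..<card C} h (key x)"
  have rank: "bij_betw ?rank C {..<card C}"
    using bij_betw_trans[OF inj_on_imp_bij_betw[OF inj] bij_betw_inv_into[OF h(1)]]
    by (simp add: comp_def)
  have h_rank: "h (?rank x) = key x" if "x \<in> C" for x
    using bij_betw_inv_into_right[OF h(1)] that by simp
  have "bij_betw Suc {..<card C} {1..card C}"
    by (simp add: bij_betw_def image_Suc_lessThan)
  then have "bij_betw (\<lambda>x. Suc (?rank x)) C {1..card C}"
    using bij_betw_trans[OF rank, of Suc] by (simp add: comp_def)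
  moreover have "?rank x < ?rank y \<longleftrightarrow> key x < key y" if "x \<in> C" "y \<in> C" for x y
  proof -
    have "?rank x \<in> {..<card C}" "?rank y \<in> {..<card C}"
      using bij_betwE[OF rank] that by auto
    from strict_mono_on_less[OF h(2) this] show ?thesis by (simp only: h_rank that)
  qed
  ultimately show ?thesis by (intro exI[of _ "\<lambda>x. Suc (?rank x)"]) simp
qed

lemma bij_betw_eq_card_le:
  assumes S: "bij_betw S C {1..card C}" and x: "x \<in> C"
  shows "S x = card {y \<in> C. S y \<le> S x}"
proof -
  have "{y \<in> {1..card C}. y \<le> S x} = {1..S x}"
    using bij_betwE[OF S] x by fastforce
  then have "bij_betw S {y \<in> C. S y \<le> S x} {1..S x}"
    using bij_betw_Collect[OF S, of "\<lambda>i. i \<le> S x" "\<lambda>y. S y \<le> S x"] by simp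
  then show ?thesis using bij_betw_same_card by fastforce
qed

text \<open>Standardization refines the order of the entries: equal entries form a horizontal strip and
  are numbered by increasing column.\<close>

definition standardizes :: "(nat \<times> nat) set \<Rightarrow> (nat \<times> nat \<Rightarrow> nat) \<Rightarrow> (nat \<times> nat \<Rightarrow> nat) \<Rightarrow> bool" where
  "standardizes C S T \<longleftrightarrow> bij_betw S C {1..card C} \<and>
     (\<forall>x\<in>C. \<forall>y\<in>C. S x < S y \<longleftrightarrow> (T x, snd x) < (T y, snd y))"

lemma standardizes_unique:
  assumes "standardizes C S T" "standardizes C S' T" "x \<in> C"
  shows "S x = S' x"
proof -
  have "S y \<le> S x \<longleftrightarrow> S' y \<le> S' x" if "y \<in> C" for y
    using assms that by (simp add: standardizes_def flip: not_less)
  then have "{y \<in> C. S y \<le> S x} = {y \<in> C. S' y \<le> S' x}" by blast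
  then show ?thesis
    using bij_betw_eq_card_le[of S C x] bij_betw_eq_card_le[of S' C x] assms
    by (simp add: standardizes_def)
qed

lemma standardizes_word:
  assumes S: "standardizes C S T" and f: "mono_on {1..card C} f"
    and T: "distribution T C = distribution f {1..card C}" and x: "x \<in> C"
  shows "T x = f (S x)"
proof -
  let ?inv = "inv_into C S"
  have bij: "bij_betw S C {1..card C}" using S by (simp add: standardizes_def)
  have "mono_on {1..card C} (\<lambda>i. T (?inv i))"
  proof (rule mono_onI)
    fix i j assume ij: "i \<in> {1..card C}" "j \<in> {1..card C}" "i \<le> j"
    then have C: "?inv i \<in> C" "?inv j \<in> C" "S (?inv i) = i" "S (?inv j) = j"
      using bij_betw_inv_into_right[OF bij] bij_betwE[OF bij_betw_inv_into[OF bij]] by auto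
    then have "i < j \<Longrightarrow> (T (?inv i), snd (?inv i)) < (T (?inv j), snd (?inv j))"
      using S unfolding standardizes_def by metis
    then show "T (?inv i) \<le> T (?inv j)" using ij(3) by (cases "i = j") auto
  qed
  moreover have "distribution (\<lambda>i. T (?inv i)) {1..card C} = distribution f {1..card C}"
    using distribution_comp_bij_betw[OF bij_betw_inv_into[OF bij], of T] T by simp
  ultimately have "T (?inv (S x)) = f (S x)"
    using mono_on_distribution_unique[OF _ f, of "\<lambda>i. T (?inv i)" "S x"] bij_betwE[OF bij] x by auto
  then show ?thesis using bij_betw_inv_into_left[OF bij x] by simp
qed

lemma syt_des_iff:
  assumes S: "bij_betw S (cells lam mu) {1..card (cells lam mu)}"
    and "x \<in> cells lam mu" "y \<in> cells lam mu" "S y = Suc (S x)"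
  shows "S x \<in> syt_des lam mu S \<longleftrightarrow> fst x < fst y"
proof -
  have "S x \<ge> 1" "S y \<le> card (cells lam mu)"
    using assms bij_betwE[OF S] by auto
  moreover have "x' = x" if "x' \<in> cells lam mu" "S x' = S x" for x'
    using assms that by (auto simp: bij_betw_def dest: inj_onD)
  moreover have "y' = y" if "y' \<in> cells lam mu" "S y' = S y" for y'
    using assms(1,3) that by (auto simp: bij_betw_def dest: inj_onD)
  ultimately show ?thesis using assms(2-4) unfolding syt_des_def by fastforce
qed

lemma syt_des_subset: "syt_des lam mu S \<subseteq> {1..card (cells lam mu) - 1}"
  by (auto simp: syt_des_def)

lemma ex_standardizes:
  assumes shape: "skew_shape lam mu" and T: "semistandard lam mu T"
  shows "\<exists>S. standardizes (cells lam mu) S T"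
proof -
  let ?C = "cells lam mu" and ?key = "\<lambda>x. (T x, snd x)"
  have strip: "\<not> fst u < fst v" if "u \<in> ?C" "v \<in> ?C" "?key u = ?key v" for u v
    using semistandard_less[OF shape T, of "fst u" "snd u" "fst v" "snd v"] that by auto
  have "inj_on ?key ?C"
  proof (rule inj_onI)
    fix u v assume "u \<in> ?C" "v \<in> ?C" "?key u = ?key v"
    then show "u = v" using strip[of u v] strip[of v u] by (simp add: prod_eq_iff)
  qed
  then show ?thesis
    unfolding standardizes_def by (intro ex_bij_betw_rank finite_cells)
qed

context
  fixes lam mu :: "nat list" and f :: "nat \<Rightarrow> nat"
  assumes shape: "skew_shape lam mu" and f: "mono_on {1..card (cells lam mu)} f"
begin

private abbreviation "C \<equiv> cells lam mu"

lemma syt_key_less_Suc: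
  assumes S: "S \<in> syt lam mu" and des: "syt_des lam mu S \<subseteq> ascents f"
    and xy: "x \<in> C" "y \<in> C" "S y = Suc (S x)"
  shows "(f (S x), snd x) < (f (S y), snd y)"
proof (cases "fst x < fst y")
  case True
  then have "S x \<in> syt_des lam mu S" using syt_des_iff[OF _ xy] S by (simp add: syt_iff)
  then show ?thesis using des xy(3) by (auto simp: ascents_def)
next
  case False
  have semistd: "semistandard lam mu S" and bij: "bij_betw S C {1..card C}"
    using S by (auto simp: syt_iff)
  have "snd x < snd y"
  proof (rule ccontr)
    assume "\<not> snd x < snd y"
    then have "S y \<le> S x"
      using semistandard_le[OF shape semistd, of "fst y" "snd y" "fst x" "snd x"] False xy by simp
    then show False using xy by simp
  qed
  moreover have "f (S x) \<le> f (S y)"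
    using bij_betwE[OF bij] xy by (intro mono_onD[OF f]) auto
  ultimately show ?thesis by auto
qed

lemma syt_key_less:
  assumes S: "S \<in> syt lam mu" and des: "syt_des lam mu S \<subseteq> ascents f"
    and xy: "x \<in> C" "y \<in> C" "S x < S y"
  shows "(f (S x), snd x) < (f (S y), snd y)"
proof -
  have bij: "bij_betw S C {1..card C}" using S by (simp add: syt_iff)
  let ?key = "\<lambda>i. (f i, snd (inv_into C S i))"
  have key_less: "1 \<le> i \<Longrightarrow> j \<le> card C \<Longrightarrow> ?key i < ?key j" if "i < j" for i j
    using that
  proof (induction rule: less_Suc_induct)
    case (1 i)
    then show ?case
      using syt_key_less_Suc[OF S des, of "inv_into C S i" "inv_into C S (Suc i)"]
        bij_betw_inv_into_right[OF bij] bij_betwE[OF bij_betw_inv_into[OF bij]] by simp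
  next
    case (2 i j k)
    then show ?case by (meson less_imp_le order.strict_trans order_trans)
  qed
  have "1 \<le> S x" "S y \<le> card C" using bij_betwE[OF bij] xy by auto
  then show ?thesis using key_less[OF xy(3)] bij_betw_inv_into_left[OF bij] xy by simp
qed

lemma syt_imp_standardizes:
  assumes S: "S \<in> syt lam mu" and des: "syt_des lam mu S \<subseteq> ascents f"
    and T: "\<And>x. x \<in> C \<Longrightarrow> T x = f (S x)" "\<And>x. x \<notin> C \<Longrightarrow> T x = 0"
  shows "semistandard lam mu T" and "standardizes C S T"
proof -
  have key_less: "(T x, snd x) < (T y, snd y)" if "x \<in> C" "y \<in> C" "S x < S y" for x y
    using syt_key_less[OF S des that] T that by simp
  have bij: "bij_betw S C {1..card C}" using S by (simp add: syt_iff)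
  have "S x < S y" if xy: "x \<in> C" "y \<in> C" "(T x, snd x) < (T y, snd y)" for x y
  proof (rule ccontr)
    assume "\<not> S x < S y"
    then consider "S y < S x" | "x = y"
      using xy bij by (auto simp: bij_betw_def dest: inj_onD linorder_neqE_nat)
    then show False using key_less[of y x] xy by cases (auto simp del: less_prod_simp)
  qed
  then show "standardizes C S T" using bij key_less unfolding standardizes_def by blast
  show "semistandard lam mu T"
    unfolding semistandard_def
  proof (intro conjI allI impI)
    fix r c assume "(r, c) \<in> C \<and> (r, c + 1) \<in> C"
    then show "T (r, c) \<le> T (r, c + 1)"
      using key_less[of "(r, c)" "(r, c + 1)"] S by (auto simp: syt_def)
  next
    fix r c assume "(r, c) \<in> C \<and> (r + 1, c) \<in> C"
    then show "T (r, c) < T (r + 1, c)"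
      using key_less[of "(r, c)" "(r + 1, c)"] S by (auto simp: syt_def)
  qed (simp add: T)
qed

lemma standardizes_imp_syt:
  assumes T: "semistandard lam mu T" and S: "standardizes C S T"
    and S0: "\<And>x. x \<notin> C \<Longrightarrow> S x = 0" and Tf: "\<And>x. x \<in> C \<Longrightarrow> T x = f (S x)"
  shows "S \<in> syt lam mu" and "syt_des lam mu S \<subseteq> ascents f"
proof -
  have bij: "bij_betw S C {1..card C}" and less_iff: "\<And>x y. x \<in> C \<Longrightarrow> y \<in> C \<Longrightarrow>
      S x < S y \<longleftrightarrow> (T x, snd x) < (T y, snd y)"
    using S by (auto simp: standardizes_def)
  have "S (r, c) < S (r, c + 1)" if "(r, c) \<in> C" "(r, c + 1) \<in> C" for r c
    using that T less_iff by (auto simp: semistandard_def)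
  moreover have "S (r, c) < S (r + 1, c)" if "(r, c) \<in> C" "(r + 1, c) \<in> C" for r c
    using that T less_iff by (auto simp: semistandard_def)
  ultimately show "S \<in> syt lam mu" using S0 bij by (simp add: syt_def)
  show "syt_des lam mu S \<subseteq> ascents f"
  proof
    fix i assume i: "i \<in> syt_des lam mu S"
    then obtain u v where uv: "u \<in> C" "v \<in> C" "S u = i" "S v = Suc i" "fst u < fst v"
      by (auto simp: syt_des_def)
    have "T u \<noteq> T v"
    proof
      assume eq: "T u = T v"
      then have "snd u < snd v" using less_iff[OF uv(1,2)] uv by simp
      then show False using semistandard_less[OF shape T, of "fst u" "snd u" "fst v" "snd v"] uv eq
        by simp
    qed
    then have "f i \<noteq> f (Suc i)" using Tf uv by metis
    moreover have "f i \<le> f (Suc i)" using i by (intro mono_onD[OF f]) (auto simp: syt_des_def)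
    ultimately show "i \<in> ascents f" by (simp add: ascents_def)
  qed
qed

lemma ssyt_obtain_standardization:
  assumes "T \<in> ssyt lam mu (count (distribution f {1..card C}))"
  obtains S where "S \<in> syt lam mu" "syt_des lam mu S \<subseteq> ascents f" "\<And>x. x \<in> C \<Longrightarrow> T x = f (S x)"
proof -
  have T: "semistandard lam mu T" "distribution T C = distribution f {1..card C}"
    using assms by (auto simp: ssyt_iff count_inject)
  obtain S0 where S0: "standardizes C S0 T" using ex_standardizes[OF shape T(1)] by blast
  define S where "S x = (if x \<in> C then S0 x else 0)" for x
  have S: "standardizes C S T"
    using S0 by (simp add: standardizes_def S_def cong: bij_betw_cong)
  have T_eq: "T x = f (S x)" if "x \<in> C" for x
    using standardizes_word[OF S f T(2) that] .
  have "S x = 0" if "x \<notin> C" for x using that by (simp add: S_def)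
  from standardizes_imp_syt[OF T(1) S this T_eq] T_eq show thesis by (rule that)
qed

proposition kostka_distribution_eq_card_syt:
  "kostka lam mu (distribution f {1..card C}) = card {S \<in> syt lam mu. syt_des lam mu S \<subseteq> ascents f}"
proof -
  let ?A = "{S \<in> syt lam mu. syt_des lam mu S \<subseteq> ascents f}"
  let ?word = "\<lambda>S x. if x \<in> C then f (S x) else 0"
  have word: "semistandard lam mu (?word S)" "standardizes C S (?word S)" if "S \<in> ?A" for S
    using syt_imp_standardizes[of S "?word S"] that by auto
  have "inj_on ?word ?A"
  proof (rule inj_onI)
    fix S S' assume S: "S \<in> ?A" "S' \<in> ?A" and eq: "?word S = ?word S'"
    have "S x = S' x" if "x \<in> C" for x
      using standardizes_unique[OF word(2)[OF S(1)] _ that] word(2)[OF S(2)] unfolding eq by blast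
    moreover have "S x = S' x" if "x \<notin> C" for x
      using S that by (cases x) (auto simp: syt_def)
    ultimately show "S = S'" by blast
  qed
  moreover have "?word ` ?A = ssyt lam mu (count (distribution f {1..card C}))"
  proof (intro equalityI subsetI)
    fix T assume "T \<in> ?word ` ?A"
    then obtain S where S: "S \<in> ?A" and T: "T = ?word S" by blast
    have "distribution T C = distribution (\<lambda>x. f (S x)) C"
      by (auto simp: T intro: distribution_cong)
    also have "\<dots> = distribution f {1..card C}"
      using S by (intro distribution_comp_bij_betw) (simp add: syt_iff)
    finally show "T \<in> ssyt lam mu (count (distribution f {1..card C}))"
      using word(1)[OF S] by (simp add: ssyt_iff T)
  next
    fix T assume T: "T \<in> ssyt lam mu (count (distribution f {1..card C}))"
    then obtain S where "S \<in> ?A" "\<And>x. x \<in> C \<Longrightarrow> T x = f (S x)"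
      by (rule ssyt_obtain_standardization) blast
    moreover have "T x = 0" if "x \<notin> C" for x using T that unfolding ssyt_iff semistandard_def
      by blast
    ultimately show "T \<in> ?word ` ?A" by (intro image_eqI[of _ _ S]) auto
  qed
  ultimately show ?thesis unfolding kostka_def by (metis (no_types, lifting) card_image)
qed

end

section \<open>Symmetry of skew Schur functions\<close>

text \<open>Gelfand-Tsetlin patterns: \<open>G v r\<close> is the right end of the cells of row \<open>r\<close> with entries
  smaller than \<open>v\<close>.\<close>

definition gt_patterns ::
    "nat list \<Rightarrow> nat list \<Rightarrow> (nat \<Rightarrow> nat) \<Rightarrow> (nat \<Rightarrow> nat \<Rightarrow> nat) set" where
  "gt_patterns lam mu alpha = {G. (\<forall>r. G 0 r = part mu r) \<and>
     (\<forall>v r. G v r \<le> G (Suc v) r) \<and> (\<forall>v r. G (Suc v) (Suc r) \<le> G v r) \<and>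
     (\<exists>V. \<forall>v\<ge>V. \<forall>r. G v r = part lam r) \<and>
     (\<forall>v. (\<Sum>r<length lam. G (Suc v) r) = (\<Sum>r<length lam. G v r) + alpha v)}"

definition pattern_of :: "nat list \<Rightarrow> nat list \<Rightarrow> (nat \<times> nat \<Rightarrow> nat) \<Rightarrow> nat \<Rightarrow> nat \<Rightarrow> nat" where
  "pattern_of lam mu T v r = part mu r + card {c. (r, c) \<in> cells lam mu \<and> T (r, c) < v}"

definition tableau_of :: "nat list \<Rightarrow> nat list \<Rightarrow> (nat \<Rightarrow> nat \<Rightarrow> nat) \<Rightarrow> nat \<times> nat \<Rightarrow> nat" where
  "tableau_of lam mu G x = (if x \<in> cells lam mu then LEAST v. snd x < G (Suc v) (fst x) else 0)"

lemma nat_leI_less: "(\<And>c. c < a \<Longrightarrow> c < b) \<Longrightarrow> a \<le> (b::nat)"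
  by (meson leI less_irrefl)

lemma nat_eqI_less: "(\<And>c. c < a \<longleftrightarrow> c < b) \<Longrightarrow> a = (b::nat)"
  by (meson nat_neq_iff)

lemma down_closed_eq_lessThan:
  fixes S :: "nat set"
  assumes down: "\<And>c d. d \<in> S \<Longrightarrow> c \<le> d \<Longrightarrow> c \<in> S" and "finite S"
  shows "S = {..<card S}"
proof -
  define n where "n = (LEAST n. n \<notin> S)"
  have "\<exists>n. n \<notin> S" using ex_new_if_finite[OF infinite_UNIV_nat \<open>finite S\<close>] .
  then have "n \<notin> S" unfolding n_def by (rule LeastI_ex)
  then have "c < n" if "c \<in> S" for c using down[OF that] by (meson not_le)
  moreover have "c \<in> S" if "c < n" for c using not_less_Least[OF that[unfolded n_def]] by simp
  ultimately have "S = {..<n}" by blast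
  then show ?thesis by simp
qed

lemma finite_row_cells [simp]: "finite {c. (r, c) \<in> cells lam mu \<and> P c}"
  by (rule finite_subset[of _ "{..<part lam r}"]) (auto simp: mem_cells_iff)

lemma sum_pattern_of:
  "(\<Sum>r<length lam. pattern_of lam mu T v r) =
     (\<Sum>r<length lam. part mu r) + card {x \<in> cells lam mu. T x < v}"
proof -
  have "{x \<in> cells lam mu. T x < v} =
      (SIGMA r:{..<length lam}. {c. (r, c) \<in> cells lam mu \<and> T (r, c) < v})"
    by (auto simp: cells_def)
  then show ?thesis by (simp add: pattern_of_def sum.distrib)
qed

lemma card_less_Suc_distribution:
  fixes T :: "'a \<Rightarrow> nat"
  assumes "finite C"
  shows "card {x \<in> C. T x < Suc v} = card {x \<in> C. T x < v} + count (distribution T C) v"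
proof -
  have "{x \<in> C. T x < Suc v} = {x \<in> C. T x < v} \<union> {x \<in> C. T x = v}" by auto
  moreover have "card \<dots> = card {x \<in> C. T x < v} + card {x \<in> C. T x = v}"
    using assms by (intro card_Un_disjoint) auto
  ultimately show ?thesis using assms by (simp add: count_distribution)
qed

lemma gt_patterns_mono:
  assumes "G \<in> gt_patterns lam mu alpha" "v \<le> w"
  shows "G v r \<le> G w r"
  using assms(2) assms(1) lift_Suc_mono_le[of "\<lambda>v. G v r" v w] by (auto simp: gt_patterns_def)

lemma gt_patterns_bounds:
  assumes "G \<in> gt_patterns lam mu alpha"
  shows "part mu r \<le> G v r" "G v r \<le> part lam r"
proof -
  obtain V where "\<forall>v\<ge>V. \<forall>r. G v r = part lam r" using assms by (auto simp: gt_patterns_def)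
  then have "G (max v V) r = part lam r" by simp
  then show "G v r \<le> part lam r" using gt_patterns_mono[OF assms, of v "max v V" r] by simp
  show "part mu r \<le> G v r"
    using gt_patterns_mono[OF assms, of 0 v r] assms by (simp add: gt_patterns_def)
qed

lemma tableau_of_less_iff:
  assumes G: "G \<in> gt_patterns lam mu alpha" and rc: "(r, c) \<in> cells lam mu"
  shows "tableau_of lam mu G (r, c) < v \<longleftrightarrow> c < G v r"
proof -
  obtain V where V: "\<forall>v\<ge>V. \<forall>r. G v r = part lam r" using G by (auto simp: gt_patterns_def)
  let ?reached = "\<lambda>v. c < G (Suc v) r"
  have least: "tableau_of lam mu G (r, c) = (LEAST v. ?reached v)" using rc
    by (simp add: tableau_of_def)
  have "?reached V" using V rc by (simp add: mem_cells_iff)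
  then have reached: "?reached (tableau_of lam mu G (r, c))" unfolding least by (rule LeastI)
  show ?thesis
  proof
    assume "tableau_of lam mu G (r, c) < v"
    then have "G (Suc (tableau_of lam mu G (r, c))) r \<le> G v r"
      by (intro gt_patterns_mono[OF G]) simp
    then show "c < G v r" using reached by simp
  next
    assume less: "c < G v r"
    then obtain w where w: "v = Suc w"
      using G rc by (cases v) (auto simp: gt_patterns_def mem_cells_iff)
    then have "tableau_of lam mu G (r, c) \<le> w" unfolding least using less by (intro Least_le) simp
    then show "tableau_of lam mu G (r, c) < v" using w by simp
  qed
qed

lemma semistandard_tableau_of:
  assumes G: "G \<in> gt_patterns lam mu alpha"
  shows "semistandard lam mu (tableau_of lam mu G)"
  unfolding semistandard_def
proof (intro conjI allI impI)
  fix r c assume rc: "(r, c) \<in> cells lam mu \<and> (r, c + 1) \<in> cells lam mu"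
  let ?v = "tableau_of lam mu G (r, c + 1)"
  have "c + 1 < G (Suc ?v) r" using tableau_of_less_iff[OF G, of r "c + 1" "Suc ?v"] rc by blast
  then have "tableau_of lam mu G (r, c) < Suc ?v"
    using tableau_of_less_iff[OF G, of r c "Suc ?v"] rc by simp
  then show "tableau_of lam mu G (r, c) \<le> ?v" by simp
next
  fix r c assume rc: "(r, c) \<in> cells lam mu \<and> (r + 1, c) \<in> cells lam mu"
  let ?v = "tableau_of lam mu G (r + 1, c)"
  have "c < G (Suc ?v) (Suc r)" using tableau_of_less_iff[OF G, of "r + 1" c "Suc ?v"] rc by simp
  also have "\<dots> \<le> G ?v r" using G by (simp add: gt_patterns_def)
  finally show "tableau_of lam mu G (r, c) < ?v" using tableau_of_less_iff[OF G, of r c ?v] rc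
    by simp
qed (simp add: tableau_of_def)

context
  fixes lam mu :: "nat list"
  assumes shape: "skew_shape lam mu"
begin

lemma less_pattern_of_iff:
  assumes T: "semistandard lam mu T"
  shows "c < pattern_of lam mu T v r \<longleftrightarrow> c < part mu r \<or> (r, c) \<in> cells lam mu \<and> T (r, c) < v"
proof -
  let ?S = "{c. (r, c) \<in> cells lam mu \<and> T (r, c) < v}" and ?k = "part mu r"
  have "{..<?k} \<union> ?S = {..<card ({..<?k} \<union> ?S)}"
  proof (rule down_closed_eq_lessThan)
    fix c d assume d: "d \<in> {..<?k} \<union> ?S" "c \<le> d"
    show "c \<in> {..<?k} \<union> ?S"
    proof (cases "c < ?k")
      case False
      then have "(r, c) \<in> cells lam mu" "(r, d) \<in> cells lam mu" "T (r, d) < v" using d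
        by (auto simp: mem_cells_iff)
      then show ?thesis using semistandard_row[OF shape T, of r c d] d(2) by simp
    qed simp
  qed simp
  moreover have "card ({..<?k} \<union> ?S) = pattern_of lam mu T v r"
    unfolding pattern_of_def by (subst card_Un_disjoint) (auto simp: mem_cells_iff)
  ultimately have "c \<in> {..<?k} \<union> ?S \<longleftrightarrow> c \<in> {..<pattern_of lam mu T v r}" by simp
  then show ?thesis by simp
qed

lemma pattern_of_in_gt_patterns:
  assumes T: "T \<in> ssyt lam mu alpha"
  shows "pattern_of lam mu T \<in> gt_patterns lam mu alpha"
proof -
  have semistd: "semistandard lam mu T" and alpha: "count (distribution T (cells lam mu)) = alpha"
    using T by (auto simp: ssyt_iff)
  note less_iff = less_pattern_of_iff[OF semistd]
  have "pattern_of lam mu T 0 r = part mu r" for r by (simp add: pattern_of_def)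
  moreover have "pattern_of lam mu T v r \<le> pattern_of lam mu T (Suc v) r" for v r
    by (rule nat_leI_less) (auto simp: less_iff)
  moreover have "pattern_of lam mu T (Suc v) (Suc r) \<le> pattern_of lam mu T v r" for v r
  proof (rule nat_leI_less)
    fix c assume "c < pattern_of lam mu T (Suc v) (Suc r)"
    moreover have "part mu (Suc r) \<le> part mu r" "part lam (Suc r) \<le> part lam r"
      using shape part_antimono[of _ r "Suc r"] by (auto simp: skew_shape_iff)
    ultimately show "c < pattern_of lam mu T v r"
      using semistandard_column[OF shape semistd, of r c "Suc r"]
      by (force simp: less_iff mem_cells_iff)
  qed
  moreover have "\<exists>V. \<forall>v\<ge>V. \<forall>r. pattern_of lam mu T v r = part lam r"
  proof -
    obtain V where V: "\<forall>y\<in>T ` cells lam mu. y < V"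
      using finite_nat_set_iff_bounded[of "T ` cells lam mu"] by auto
    have "pattern_of lam mu T v r = part lam r" if "v \<ge> V" for v r
    proof (rule nat_eqI_less)
      fix c
      have "T (r, c) < v" if "(r, c) \<in> cells lam mu" using V \<open>v \<ge> V\<close> that by fastforce
      moreover have "part mu r \<le> part lam r" using shape by (simp add: skew_shape_iff)
      ultimately show "c < pattern_of lam mu T v r \<longleftrightarrow> c < part lam r"
        by (auto simp: less_iff mem_cells_iff)
    qed
    then show ?thesis by blast
  qed
  moreover have "(\<Sum>r<length lam. pattern_of lam mu T (Suc v) r) =
      (\<Sum>r<length lam. pattern_of lam mu T v r) + alpha v" for v
    unfolding sum_pattern_of card_less_Suc_distribution[OF finite_cells] alpha by simp
  ultimately show ?thesis by (simp add: gt_patterns_def)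
qed

lemma pattern_of_tableau_of:
  assumes G: "G \<in> gt_patterns lam mu alpha"
  shows "pattern_of lam mu (tableau_of lam mu G) = G"
proof (intro ext nat_eqI_less)
  fix v r c
  show "c < pattern_of lam mu (tableau_of lam mu G) v r \<longleftrightarrow> c < G v r"
    using less_pattern_of_iff[OF semistandard_tableau_of[OF G], of c v r]
      tableau_of_less_iff[OF G, of r c v]
      gt_patterns_bounds(1)[OF G, of r v] gt_patterns_bounds(2)[OF G, of v r]
    by (auto simp: mem_cells_iff)
qed

lemma tableau_of_in_ssyt:
  assumes G: "G \<in> gt_patterns lam mu alpha"
  shows "tableau_of lam mu G \<in> ssyt lam mu alpha"
proof -
  have "count (distribution (tableau_of lam mu G) (cells lam mu)) v = alpha v" for v
  proof -
    have "(\<Sum>r<length lam. G (Suc v) r) = (\<Sum>r<length lam. G v r) + alpha v"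
      using G by (simp add: gt_patterns_def)
    then show ?thesis
      using sum_pattern_of[of lam mu "tableau_of lam mu G"]
        card_less_Suc_distribution[OF finite_cells]
      unfolding pattern_of_tableau_of[OF G] by simp
  qed
  then show ?thesis using semistandard_tableau_of[OF G] by (auto simp: ssyt_iff)
qed

lemma tableau_of_pattern_of:
  assumes T: "T \<in> ssyt lam mu alpha"
  shows "tableau_of lam mu (pattern_of lam mu T) = T"
proof
  fix x
  have semistd: "semistandard lam mu T" using T by (simp add: ssyt_iff)
  show "tableau_of lam mu (pattern_of lam mu T) x = T x"
  proof (cases "x \<in> cells lam mu")
    case True
    obtain r c where x: "x = (r, c)" by (cases x)
    have "tableau_of lam mu (pattern_of lam mu T) x < v \<longleftrightarrow> T x < v" for v
      using tableau_of_less_iff[OF pattern_of_in_gt_patterns[OF T], of r c v]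
        less_pattern_of_iff[OF semistd, of c v r]
        True x by (simp add: mem_cells_iff)
    then show ?thesis by (meson nat_neq_iff)
  next
    case False
    then have "T x = 0" using semistd unfolding semistandard_def by blast
    with False show ?thesis by (simp add: tableau_of_def)
  qed
qed

lemma card_ssyt_eq_card_gt_patterns:
  "card (ssyt lam mu alpha) = card (gt_patterns lam mu alpha)"
proof (rule bij_betw_same_card)
  show "bij_betw (pattern_of lam mu) (ssyt lam mu alpha) (gt_patterns lam mu alpha)"
    by (rule bij_betw_byWitness[where f' = "tableau_of lam mu"])
      (auto simp: pattern_of_in_gt_patterns tableau_of_in_ssyt
        pattern_of_tableau_of tableau_of_pattern_of)
qed

end

text \<open>The Bender-Knuth involution: in a Gelfand-Tsetlin pattern the entries \<open>G (i + 1) r\<close> range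
  independently over intervals determined by the levels \<open>i\<close> and \<open>i + 2\<close>; each entry is reflected in
  its interval.\<close>

definition toggle_lower :: "nat \<Rightarrow> (nat \<Rightarrow> nat \<Rightarrow> nat) \<Rightarrow> nat \<Rightarrow> nat" where
  "toggle_lower i G r = max (G i r) (G (Suc (Suc i)) (Suc r))"

definition toggle_upper :: "nat \<Rightarrow> (nat \<Rightarrow> nat \<Rightarrow> nat) \<Rightarrow> nat \<Rightarrow> nat" where
  "toggle_upper i G r = (case r of 0 \<Rightarrow> G (Suc (Suc i)) 0 | Suc s \<Rightarrow> min (G (Suc (Suc i)) r) (G i s))"

definition toggle :: "nat \<Rightarrow> (nat \<Rightarrow> nat \<Rightarrow> nat) \<Rightarrow> nat \<Rightarrow> nat \<Rightarrow> nat" where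
  "toggle i G = G(Suc i := \<lambda>r. toggle_lower i G r + toggle_upper i G r - G (Suc i) r)"

lemma toggle_other: "v \<noteq> Suc i \<Longrightarrow> toggle i G v = G v"
  by (simp add: toggle_def)

lemma sum_toggle_bounds:
  assumes "G (Suc (Suc i)) n = 0"
  shows "(\<Sum>r<n. toggle_lower i G r) + (\<Sum>r<n. toggle_upper i G r) =
    (\<Sum>r<n. G i r) + (\<Sum>r<n. G (Suc (Suc i)) r)"
proof -
  have telescope: "(\<Sum>r<k. toggle_lower i G r) + (\<Sum>r<Suc k. toggle_upper i G r) =
      (\<Sum>r<k. G i r) + (\<Sum>r<Suc k. G (Suc (Suc i)) r)" for k
  proof (induction k)
    case (Suc k)
    have "toggle_lower i G k + toggle_upper i G (Suc k) = G i k + G (Suc (Suc i)) (Suc k)"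
      by (auto simp: toggle_lower_def toggle_upper_def max_def min_def)
    then show ?case using Suc by simp
  qed (simp add: toggle_upper_def)
  have "toggle_upper i G n = 0" using assms by (auto simp: toggle_upper_def split: nat.split)
  then show ?thesis using telescope[of n] assms by simp
qed

context
  fixes lam mu :: "nat list" and alpha :: "nat \<Rightarrow> nat" and i :: nat and G :: "nat \<Rightarrow> nat \<Rightarrow> nat"
  assumes G: "G \<in> gt_patterns lam mu alpha"
begin

lemma toggle_bounds:
  "toggle_lower i G r \<le> G (Suc i) r" "G (Suc i) r \<le> toggle_upper i G r"
  using G by (auto simp: toggle_lower_def toggle_upper_def gt_patterns_def split: nat.split)

lemma toggle_within_bounds:
  "toggle_lower i G r \<le> toggle i G (Suc i) r" "toggle i G (Suc i) r \<le> toggle_upper i G r"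
  using toggle_bounds[of r] by (auto simp: toggle_def)

lemma toggle_toggle: "toggle i (toggle i G) = G"
proof (intro ext)
  fix v r
  have "toggle_lower i (toggle i G) = toggle_lower i G"
    and "toggle_upper i (toggle i G) = toggle_upper i G"
    by (auto simp: fun_eq_iff toggle_lower_def toggle_upper_def toggle_other split: nat.split)
  then show "toggle i (toggle i G) v r = G v r"
    using toggle_bounds[of r] by (auto simp: toggle_def)
qed

lemma sum_toggle:
  "(\<Sum>r<length lam. toggle i G (Suc v) r) =
     (\<Sum>r<length lam. toggle i G v r) + (alpha \<circ> transpose i (Suc i)) v"
proof -
  let ?s = "\<lambda>v. \<Sum>r<length lam. G v r"
  have sum: "?s (Suc v) = ?s v + alpha v" for v using G by (simp add: gt_patterns_def)
  have "G (Suc (Suc i)) (length lam) = 0"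
    using gt_patterns_bounds(2)[OF G, of "Suc (Suc i)" "length lam"] by (simp add: part_def)
  moreover have "toggle i G (Suc i) r + G (Suc i) r = toggle_lower i G r + toggle_upper i G r" for r
    using toggle_bounds[of r] by (simp add: toggle_def)
  ultimately have "(\<Sum>r<length lam. toggle i G (Suc i) r) + ?s (Suc i) = ?s i + ?s (Suc (Suc i))"
    using sum_toggle_bounds[of G i "length lam"] by (simp flip: sum.distrib)
  then have "(\<Sum>r<length lam. toggle i G (Suc i) r) = ?s i + alpha (Suc i)"
    using sum[of i] sum[of "Suc i"] by simp
  then show ?thesis using sum[of v] sum[of i]
    by (cases "v = Suc i"; cases "v = i") (auto simp: toggle_other)
qed

lemma toggle_in_gt_patterns: "toggle i G \<in> gt_patterns lam mu (alpha \<circ> transpose i (Suc i))"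
proof -
  have zero: "G 0 r = part mu r" and up: "G v r \<le> G (Suc v) r" and diag: "G (Suc v) (Suc r) \<le> G v r"
    for v r using G by (auto simp: gt_patterns_def)
  have lower: "G i r \<le> toggle_lower i G r" "G (Suc (Suc i)) (Suc r) \<le> toggle_lower i G r" for r
    by (auto simp: toggle_lower_def)
  have upper: "toggle_upper i G r \<le> G (Suc (Suc i)) r" "toggle_upper i G (Suc r) \<le> G i r" for r
    by (auto simp: toggle_upper_def split: nat.split)
  have "toggle i G 0 r = part mu r" for r by (simp add: toggle_other zero)
  moreover have "toggle i G v r \<le> toggle i G (Suc v) r" for v r
    using up[of v r] toggle_within_bounds[of r] lower[of r] upper[of r]
    by (cases "v = Suc i"; cases "v = i") (auto simp: toggle_other)
  moreover have "toggle i G (Suc v) (Suc r) \<le> toggle i G v r" for v r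
    using diag[of v r] toggle_within_bounds[of r] toggle_within_bounds[of "Suc r"]
      lower[of r] upper[of r]
    by (cases "v = Suc i"; cases "v = i") (auto simp: toggle_other)
  moreover have "\<exists>V. \<forall>v\<ge>V. \<forall>r. toggle i G v r = part lam r"
  proof -
    obtain V where "\<forall>v\<ge>V. \<forall>r. G v r = part lam r" using G by (auto simp: gt_patterns_def)
    then have "\<forall>v\<ge>max V (Suc (Suc i)). \<forall>r. toggle i G v r = part lam r" by (auto simp: toggle_other)
    then show ?thesis by blast
  qed
  ultimately show ?thesis using sum_toggle by (simp add: gt_patterns_def)
qed

end

lemma card_ssyt_adjacent_transpose:
  assumes "skew_shape lam mu"
  shows "card (ssyt lam mu (alpha \<circ> transpose i (Suc i))) = card (ssyt lam mu alpha)"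
proof -
  have "alpha \<circ> transpose i (Suc i) \<circ> transpose i (Suc i) = alpha"
    by (simp add: comp_assoc)
  then have reverse: "toggle i G \<in> gt_patterns lam mu alpha"
    if "G \<in> gt_patterns lam mu (alpha \<circ> transpose i (Suc i))" for G
    using toggle_in_gt_patterns[OF that, of i] by simp
  have "bij_betw (toggle i) (gt_patterns lam mu (alpha \<circ> transpose i (Suc i)))
      (gt_patterns lam mu alpha)"
    by (rule bij_betw_byWitness[where f' = "toggle i"])
      (auto simp: toggle_toggle reverse toggle_in_gt_patterns)
  then show ?thesis using assms by (simp add: card_ssyt_eq_card_gt_patterns bij_betw_same_card)
qed

lemma card_ssyt_transpose:
  assumes "skew_shape lam mu"
  shows "card (ssyt lam mu (alpha \<circ> transpose a b)) = card (ssyt lam mu alpha)"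
proof (induction a b arbitrary: alpha rule: linorder_wlog)
  case (le a b)
  then show ?case
  proof (induction b arbitrary: alpha rule: dec_induct)
    case (step b)
    show ?case
    proof (cases "a = b")
      case False
      let ?t = "transpose b (Suc b)"
      have "?t \<circ> transpose a b \<circ> ?t = transpose a (Suc b)"
        using False step.hyps by (auto simp: fun_eq_iff transpose_def)
      then have "alpha \<circ> transpose a (Suc b) = ((alpha \<circ> ?t) \<circ> transpose a b) \<circ> ?t"
        by (metis comp_assoc)
      then show ?thesis
        using step.IH[of "alpha \<circ> ?t"] card_ssyt_adjacent_transpose[OF assms] by metis
    next
      case True
      then show ?thesis using card_ssyt_adjacent_transpose[OF assms] by metis
    qed
  qed simp
qed (simp add: transpose_commute)

lemma card_ssyt_permutes:
  assumes "skew_shape lam mu" "p permutes X" "finite X"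
  shows "card (ssyt lam mu (alpha \<circ> p)) = card (ssyt lam mu alpha)"
  using assms(2,3)
proof (induction p arbitrary: alpha rule: permutes_induct)
  case (swap a b p)
  then show ?case
    using swap.IH[of "alpha \<circ> transpose a b"] card_ssyt_transpose[OF assms(1)] by (metis comp_assoc)
qed simp

proposition kostka_image_permutes:
  assumes "skew_shape lam mu" "p permutes X" "finite X"
  shows "kostka lam mu (image_mset p M) = kostka lam mu M"
proof -
  have "count (image_mset p M) (p x) = count M x" for x
    using permutes_inj[OF assms(2)] by (induction M) (auto simp: inj_eq)
  then have "count (image_mset p M) \<circ> p = count M" by (simp add: fun_eq_iff)
  then show ?thesis unfolding kostka_def using card_ssyt_permutes[OF assms] by metis
qed

section \<open>Integrality of Schur coefficients\<close>

lemma finite_partitions_of: "finite (partitions_of m)"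
proof (rule finite_subset)
  show "partitions_of m \<subseteq> {xs. set xs \<subseteq> {..m} \<and> length xs \<le> m}"
  proof
    fix lam assume lam: "lam \<in> partitions_of m"
    have "length xs \<le> sum_list xs" if "\<forall>x\<in>set xs. 0 < x" for xs :: "nat list"
      using that by (induction xs) auto
    then have "length lam \<le> m" using lam by (auto simp: partitions_of_def is_partition_def)
    moreover have "set lam \<subseteq> {..m}"
      using lam member_le_sum_list by (fastforce simp: partitions_of_def)
    ultimately show "lam \<in> {xs. set xs \<subseteq> {..m} \<and> length xs \<le> m}" by simp
  qed
qed (simp add: finite_lists_length_le)

lemma skew_shape_straight: "skew_shape lam [] \<longleftrightarrow> is_partition lam"
  by (auto simp: skew_shape_def is_partition_def)

lemma card_cells_straight: "card (cells lam []) = sum_list lam"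
proof -
  have "cells lam [] = (SIGMA r:{..<length lam}. {..<lam ! r})"
    by (auto simp: cells_def part_def)
  then show ?thesis by (simp add: sum_list_sum_nth atLeast0LessThan)
qed

lemma partitions_ofD:
  assumes "lam \<in> partitions_of m"
  shows "is_partition lam" "skew_shape lam []" "card (cells lam []) = m"
  using assms by (auto simp: partitions_of_def skew_shape_straight card_cells_straight)

lemma part_inject:
  assumes "is_partition lam" "is_partition mu" "part lam = part mu"
  shows "lam = mu"
proof -
  have len: "r < length xs \<longleftrightarrow> 0 < part xs r" if "is_partition xs" for xs r
    using that by (auto simp: part_def is_partition_def)
  have "length lam = length mu"
    by (rule nat_eqI_less) (simp add: len assms)
  moreover have "lam ! r = mu ! r" if "r < length lam" for r
    using that assms(3) \<open>length lam = length mu\<close> by (metis part_def)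
  ultimately show ?thesis by (simp add: nth_equalityI)
qed

lemma count_distribution_fst_cells: "count (distribution fst (cells lam [])) = part lam"
proof
  fix r
  have "{x \<in> cells lam []. fst x = r} = {r} \<times> {..<part lam r}"
    by (auto simp: mem_cells_iff part_def)
  then show "count (distribution fst (cells lam [])) r = part lam r"
    by (simp add: count_distribution card_cartesian_product)
qed

definition row_index_sum :: "nat list \<Rightarrow> nat" where
  "row_index_sum lam = (\<Sum>x\<in>cells lam []. fst x)"

lemma semistandard_ge_row_index:
  assumes "is_partition lam" "semistandard lam [] T" "(r, c) \<in> cells lam []"
  shows "r \<le> T (r, c)"
  using assms(3)
proof (induction r)
  case (Suc r)
  have "(r, c) \<in> cells lam []"
    using Suc.prems part_antimono[OF assms(1), of r "Suc r"] by (auto simp: mem_cells_iff part_def)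
  then have "r \<le> T (r, c)" "T (r, c) < T (Suc r, c)"
    using Suc assms(2) by (auto simp: semistandard_def)
  then show ?case by simp
qed simp

lemma ssyt_part_row_index_sum:
  assumes lam: "is_partition lam" and mu: "is_partition mu"
    and T: "T \<in> ssyt lam [] (part mu)" and ge: "row_index_sum mu \<le> row_index_sum lam"
  shows "\<And>x. x \<in> cells lam [] \<Longrightarrow> T x = fst x" and "lam = mu"
proof -
  have semistd: "semistandard lam [] T"
    and content: "count (distribution T (cells lam [])) = part mu"
    using T by (auto simp: ssyt_iff)
  have row_le: "fst x \<le> T x" if "x \<in> cells lam []" for x
    using semistandard_ge_row_index[OF lam semistd, of "fst x" "snd x"] that by simp
  have "distribution T (cells lam []) = distribution fst (cells mu [])"
    using content count_distribution_fst_cells[of mu] by (metis count_inject)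
  then have sum_entries: "sum T (cells lam []) = row_index_sum mu"
    unfolding row_index_sum_def by (rule distribution_eq_imp_sum_eq)
  show eq_row: "T x = fst x" if "x \<in> cells lam []" for x
  proof (rule ccontr)
    assume "T x \<noteq> fst x"
    then have "fst x < T x" using row_le[OF that] by simp
    then have "row_index_sum lam < sum T (cells lam [])"
      unfolding row_index_sum_def using row_le that by (intro sum_strict_mono_ex1) auto
    with sum_entries ge show False by simp
  qed
  have "part lam = part mu"
    using distribution_cong[of "cells lam []" T fst] eq_row content
    by (simp add: count_distribution_fst_cells)
  then show "lam = mu" using part_inject[OF lam mu] by blast
qed

lemma schur_part_self:
  assumes "is_partition lam"
  shows "schur lam (part lam) = 1"
proof -
  let ?T = "\<lambda>x. if x \<in> cells lam [] then fst x else 0"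
  have "distribution ?T (cells lam []) = distribution fst (cells lam [])"
    by (rule distribution_cong) simp
  then have "?T \<in> ssyt lam [] (part lam)"
    by (simp add: ssyt_iff semistandard_def count_distribution_fst_cells)
  moreover have "T = ?T" if "T \<in> ssyt lam [] (part lam)" for T
    using ssyt_part_row_index_sum(1)[OF assms assms that] that
    by (auto simp: fun_eq_iff ssyt_iff semistandard_def)
  ultimately have "ssyt lam [] (part lam) = {?T}" by blast
  then show ?thesis by (simp add: schur_def)
qed

text \<open>The Kostka matrix is unitriangular once the partitions are ordered by \<open>row_index_sum\<close>.\<close>

lemma schur_coefficients_Ints:
  fixes a :: "nat list \<Rightarrow> real"
  assumes integral: "\<And>mu. mu \<in> partitions_of m \<Longrightarrow>
      (\<Sum>lam\<in>partitions_of m. a lam * schur lam (part mu)) \<in> \<int>"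
    and mu: "mu \<in> partitions_of m"
  shows "a mu \<in> \<int>"
  using mu
proof (induction "row_index_sum mu" arbitrary: mu rule: less_induct)
  case less
  note part_mu = partitions_ofD(1)[OF less.prems]
  have "(\<Sum>lam\<in>partitions_of m. a lam * schur lam (part mu)) =
      a mu + (\<Sum>lam\<in>partitions_of m - {mu}. a lam * schur lam (part mu))"
    using sum.remove[OF finite_partitions_of less.prems, of "\<lambda>lam. a lam * schur lam (part mu)"]
      schur_part_self[OF part_mu] by simp
  moreover have "(\<Sum>lam\<in>partitions_of m - {mu}. a lam * schur lam (part mu)) \<in> \<int>"
  proof (rule Ints_sum)
    fix lam assume lam: "lam \<in> partitions_of m - {mu}"
    show "a lam * schur lam (part mu) \<in> \<int>"
    proof (cases "ssyt lam [] (part mu) = {}")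
      case False
      then obtain T where "T \<in> ssyt lam [] (part mu)" by blast
      then have "row_index_sum lam < row_index_sum mu"
        using ssyt_part_row_index_sum(2)[of lam mu T] partitions_ofD(1)[of lam m] part_mu lam
        by (auto simp flip: not_le)
      then have "a lam \<in> \<int>" using less.hyps lam by blast
      then show ?thesis by (simp add: schur_def Ints_mult)
    qed (simp add: schur_def)
  qed
  ultimately show ?case using integral[OF less.prems] by (metis Ints_diff add_diff_cancel_right')
qed

section \<open>Descent sets of a Schur-positive set\<close>

lemma fundamental_count_distribution:
  assumes f: "mono_on {1..m} f" and D: "D \<subseteq> {1..m-1}"
  shows "fundamental m D (count (distribution f {1..m})) = of_bool (D \<subseteq> ascents f)"
proof -
  let ?M = "distribution f {1..m}"
  define w0 where "w0 = map f [1..<Suc m]"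
  have content: "(\<forall>k. count_list w k = count ?M k) \<longleftrightarrow> mset w = ?M" for w
    by (simp add: multiset_eq_iff count_mset)
  have unique: "w = w0 \<longleftrightarrow> sorted w \<and> mset w = ?M" for w
    unfolding w0_def using sorted_map_upt[OF f]
    by (metis mset_map_upt properties_for_sort sorted_sort_id)
  have nth: "w0 ! i = f (Suc i)" if "i < m" for i
    using that by (simp add: w0_def del: upt_Suc)
  have "(\<forall>j\<in>D. 1 \<le> j \<and> j < m \<longrightarrow> w0 ! (j-1) < w0 ! j) \<longleftrightarrow> D \<subseteq> ascents f"
  proof -
    have "(1 \<le> j \<and> j < m \<longrightarrow> w0 ! (j-1) < w0 ! j) \<longleftrightarrow> j \<in> ascents f" if "j \<in> D" for j
    proof -
      have "1 \<le> j" "j < m" using that D by force+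
      then show ?thesis using nth[of "j - 1"] nth[of j] by (simp add: ascents_def)
    qed
    then show ?thesis by blast
  qed
  moreover have "length w0 = m" by (simp add: w0_def)
  ultimately have "(length w = m \<and> sorted w \<and> (\<forall>j\<in>D. 1 \<le> j \<and> j < m \<longrightarrow> w ! (j-1) < w ! j) \<and>
      (\<forall>k. count_list w k = count ?M k)) \<longleftrightarrow> w = w0 \<and> D \<subseteq> ascents f" for w
    unfolding content using unique[of w] by (cases "w = w0") auto
  then show ?thesis by (simp add: fundamental_def)
qed

definition block :: "nat set \<Rightarrow> nat \<Rightarrow> nat" where
  "block E i = Suc (card {e \<in> E. e < i})"

lemma block_Suc:
  assumes "finite E"
  shows "block E (Suc i) = (if i \<in> E then Suc (block E i) else block E i)"
proof -
  have "{e \<in> E. e < Suc i} = (if i \<in> E then insert i {e \<in> E. e < i} else {e \<in> E. e < i})"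
    by (auto simp: less_Suc_eq)
  then show ?thesis using assms by (simp add: block_def)
qed

lemma mono_block: "finite E \<Longrightarrow> mono (block E)"
  by (simp add: mono_iff_le_Suc block_Suc)

lemma ascents_block: "finite E \<Longrightarrow> ascents (block E) = E"
  by (auto simp: ascents_def block_Suc)

lemma schur_positive_obtain_multiplicities:
  assumes "schur_positive m A"
  obtains k :: "nat list \<Rightarrow> nat" where "\<And>alpha. (\<Sum>p\<in>A. fundamental m (des m p) alpha) =
    (\<Sum>lam\<in>partitions_of m. real (k lam) * schur lam alpha)"
proof -
  let ?P = "partitions_of m"
  obtain a :: "nat list \<Rightarrow> real" where nonneg: "\<And>lam. 0 \<le> a lam" and
    expansion: "\<And>alpha. (\<Sum>p\<in>A. fundamental m (des m p) alpha) = (\<Sum>lam\<in>?P. a lam * schur lam alpha)"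
    using assms unfolding schur_positive_def Let_def fun_eq_iff by blast
  have "a lam \<in> \<int>" if "lam \<in> ?P" for lam
    by (rule schur_coefficients_Ints[OF _ that])
      (simp add: fundamental_def Ints_sum flip: expansion)
  then have "\<exists>j. real j = a lam" if "lam \<in> ?P" for lam
    using that nonneg[of lam]
    by (metis Ints_cases of_int_of_nat_eq of_int_0_le_iff zero_le_imp_eq_int)
  then obtain k where "\<And>lam. lam \<in> ?P \<Longrightarrow> real (k lam) = a lam" by metis
  then show thesis using that[of k] by (simp add: expansion)
qed

lemma card_des_subset:
  assumes fin: "finite A" and E: "E \<subseteq> {1..m-1}"
    and expansion: "\<And>alpha. (\<Sum>p\<in>A. fundamental m (des m p) alpha) =
      (\<Sum>lam\<in>partitions_of m. real (k lam) * schur lam alpha)"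
  shows "card {p \<in> A. des m p \<subseteq> E} =
    (\<Sum>lam\<in>partitions_of m. k lam * card {S \<in> syt lam []. syt_des lam [] S \<subseteq> E})"
proof -
  have finE: "finite E" using E by (rule finite_subset) simp
  have block: "mono_on {1..m} (block E)" using mono_block[OF finE] by (rule mono_on_subset) simp
  let ?M = "distribution (block E) {1..m}"
  have "real (card {p \<in> A. des m p \<subseteq> E}) = (\<Sum>p\<in>A. of_bool (des m p \<subseteq> E))"
    using fin by (simp add: Collect_conj_eq)
  also have "\<dots> = (\<Sum>p\<in>A. fundamental m (des m p) (count ?M))"
  proof (rule sum.cong)
    fix p
    have "des m p \<subseteq> {1..m-1}" by (auto simp: des_def)
    then show "of_bool (des m p \<subseteq> E) = fundamental m (des m p) (count ?M)"
      using fundamental_count_distribution[OF block] ascents_block[OF finE] by simp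
  qed simp
  also have "\<dots> = (\<Sum>lam\<in>partitions_of m. real (k lam * kostka lam [] ?M))"
    unfolding expansion by (simp add: schur_def kostka_def)
  also have "\<dots> = (\<Sum>lam\<in>partitions_of m. real (k lam * card {S \<in> syt lam []. syt_des lam [] S \<subseteq> E}))"
  proof (rule sum.cong)
    fix lam assume "lam \<in> partitions_of m"
    then show "real (k lam * kostka lam [] ?M) =
        real (k lam * card {S \<in> syt lam []. syt_des lam [] S \<subseteq> E})"
      using kostka_distribution_eq_card_syt[of lam "[]" "block E"] partitions_ofD[of lam m] block
        ascents_block[OF finE] by simp
  qed simp
  finally show ?thesis by (simp only: of_nat_eq_iff flip: of_nat_sum)
qed

proposition schur_positive_obtain_des_distribution:
  assumes pos: "schur_positive m A" and fin: "finite A"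
  obtains k where "distribution (des m) A =
    (\<Sum>lam\<in>partitions_of m. repeat_mset (k lam) (distribution (syt_des lam []) (syt lam [])))"
proof -
  let ?des = "\<lambda>lam. distribution (syt_des lam []) (syt lam [])"
  obtain k where expansion: "\<And>alpha. (\<Sum>p\<in>A. fundamental m (des m p) alpha) =
      (\<Sum>lam\<in>partitions_of m. real (k lam) * schur lam alpha)"
    using schur_positive_obtain_multiplicities[OF pos] by blast
  have "distribution (des m) A = (\<Sum>lam\<in>partitions_of m. repeat_mset (k lam) (?des lam))"
  proof (rule multiset_eqI_size_subsets)
    fix E assume "E \<subseteq> {1..m-1}"
    then show "size {#D \<in># distribution (des m) A. D \<subseteq> E#} =
        size {#D \<in># \<Sum>lam\<in>partitions_of m. repeat_mset (k lam) (?des lam). D \<subseteq> E#}"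
      using card_des_subset[OF fin _ expansion]
      by (simp add: size_filter_sum_mset filter_repeat_mset size_filter_distribution fin)
  next
    fix D assume "D \<in># (\<Sum>lam\<in>partitions_of m. repeat_mset (k lam) (?des lam))"
    then obtain lam where lam: "lam \<in> partitions_of m" and "D \<in># repeat_mset (k lam) (?des lam)"
      by (auto simp: set_mset_sum finite_partitions_of)
    then have "D \<in># ?des lam" by (simp flip: count_greater_zero_iff)
    then show "D \<subseteq> {1..m-1}"
      using syt_des_subset[of lam "[]"] partitions_ofD(3)[OF lam]
      by (auto simp: set_mset_distribution)
  qed (use fin in \<open>auto simp: set_mset_distribution des_def\<close>)
  then show thesis by (rule that)
qed

section \<open>Cyclic shifts\<close>

lemma cyc_less: "1 \<le> i \<Longrightarrow> i < n \<Longrightarrow> cyc n i = Suc i"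
  by (simp add: cyc_def)

lemma cyc_top: "cyc n n = 1"
  by (simp add: cyc_def)

lemma cyc_permutes: "n \<ge> 1 \<Longrightarrow> cyc n permutes {1..n}"
proof (rule bij_imp_permutes)
  show "n \<ge> 1 \<Longrightarrow> bij_betw (cyc n) {1..n} {1..n}"
    by (rule bij_betw_byWitness[where f' = "\<lambda>i. if i = 1 then n else i - 1"]) (auto simp: cyc_def)
qed (auto simp: cyc_def)

lemma cyc_funpow_permutes: "n \<ge> 1 \<Longrightarrow> (cyc n ^^ k) permutes {1..n}"
  by (rule permutes_funpow[OF cyc_permutes])

lemma cyc_funpow_apply_top:
  assumes "1 \<le> k" "k \<le> n"
  shows "(cyc n ^^ k) n = k"
  using assms
proof (induction k rule: dec_induct)
  case (step k)
  then show ?case by (simp add: cyc_less)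
qed (simp add: cyc_top)

lemma cyc_funpow_eq_id:
  assumes "n \<ge> 1"
  shows "cyc n ^^ n = id"
proof
  fix i
  show "(cyc n ^^ n) i = id i"
  proof (cases "i \<in> {1..n}")
    case True
    then have "(cyc n ^^ n) i = (cyc n ^^ n) ((cyc n ^^ i) n)" by (simp add: cyc_funpow_apply_top)
    also have "\<dots> = (cyc n ^^ (n + i)) n" by (simp add: funpow_add)
    also have "\<dots> = (cyc n ^^ (i + n)) n" by (simp add: add.commute)
    also have "\<dots> = i" using True assms by (simp add: funpow_add cyc_funpow_apply_top)
    finally show ?thesis by simp
  next
    case False
    then show ?thesis using permutes_not_in[OF cyc_funpow_permutes[OF assms]] by simp
  qed
qed

lemma cyc_funpow_diff_comp: "n \<ge> 1 \<Longrightarrow> k \<le> n \<Longrightarrow> cyc n ^^ (n - k) \<circ> cyc n ^^ k = id"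
  by (simp add: cyc_funpow_eq_id flip: funpow_add)

lemma cyc_funpow_diff_apply: "k \<in> {1..n} \<Longrightarrow> (cyc n ^^ (n - k)) k = n"
  using fun_cong[OF cyc_funpow_diff_comp[of n k], of n] by (simp add: cyc_funpow_apply_top)

lemma cyclic_group_eq:
  assumes "n \<ge> 1"
  shows "cyclic_group n = (\<lambda>k. cyc n ^^ (n - k)) ` {1..n}"
proof -
  have "cyc n ^^ j \<in> (\<lambda>k. cyc n ^^ (n - k)) ` {1..n}" for j
  proof
    have mod_less: "j mod n < n" using assms by simp
    have "cyc n ^^ j = cyc n ^^ (j mod n)"
      using funpow_mod_eq[where f = "cyc n" and n = n and m = j] cyc_funpow_eq_id[OF assms]
      by (simp add: fun_eq_iff)
    then show "cyc n ^^ j = cyc n ^^ (n - (n - j mod n))" using mod_less by simp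
    show "n - j mod n \<in> {1..n}" using mod_less by auto
  qed
  then show ?thesis by (auto simp: cyclic_group_def)
qed

lemma shift1_eq_cyc_image: "J \<subseteq> {1..n} \<Longrightarrow> shift1 n J = cyc n ` J"
  unfolding shift1_def by (rule image_cong) (auto simp: cyc_def)

lemma cdes_eq_cyc: "cdes n p = {i \<in> {1..n}. p (cyc n i) < p i}"
  by (auto simp: cdes_def cyc_def)

lemma image_cdes_comp_cyc_funpow: "(cyc n ^^ k) ` cdes n (p \<circ> cyc n ^^ k) = cdes n p"
proof (cases "n \<ge> 1")
  case True
  show ?thesis
  proof (intro set_eqI)
    fix i
    let ?c = "cyc n ^^ k"
    note perm = cyc_funpow_permutes[OF True, of k]
    have "i \<in> ?c ` cdes n (p \<circ> ?c) \<longleftrightarrow> inv ?c i \<in> cdes n (p \<circ> ?c)"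
      using permutes_inverses[OF perm] by (metis image_iff)
    also have "\<dots> \<longleftrightarrow> i \<in> cdes n p"
      using permutes_in_image[OF permutes_inv[OF perm], of i] permutes_inverses(1)[OF perm, of i]
      by (auto simp: cdes_eq_cyc simp flip: funpow_swap1)
    finally show "i \<in> ?c ` cdes n (p \<circ> ?c) \<longleftrightarrow> i \<in> cdes n p" .
  qed
qed (simp add: cdes_eq_cyc)

lemma cdes_eq_insert_des:
  assumes n: "n \<ge> 2" and s: "s permutes {1..n-1}"
  shows "cdes n s = insert n (des (n - 1) s)"
proof -
  have fix_n: "s n = n" using permutes_not_in[OF s, of n] n by auto
  have less: "s i < n" if "1 \<le> i" "i \<le> n - 1" for i
    using permutes_in_image[OF s, of i] that n by auto
  have "i \<in> cdes n s \<longleftrightarrow> i = n \<or> i \<in> des (n - 1) s" for i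
  proof -
    consider (top) "i = n" | (below_top) "i = n - 1" | (other) "i < n - 1 \<or> n < i" by linarith
    then show ?thesis
    proof cases
      case top
      then show ?thesis using less[of 1] fix_n n by (simp add: cdes_def)
    next
      case below_top
      then show ?thesis using less[of "n - 1"] fix_n n by (auto simp: cdes_def des_def)
    qed (use n in \<open>auto simp: cdes_def des_def\<close>)
  qed
  then show ?thesis by blast
qed

definition rotated :: "nat \<Rightarrow> nat \<Rightarrow> nat set \<Rightarrow> nat set" where
  "rotated n k D = (cyc n ^^ k) ` insert n D"

definition rotations :: "nat \<Rightarrow> nat set multiset \<Rightarrow> nat set multiset" where
  "rotations n M = (\<Sum>k=1..n. image_mset (rotated n k) M)"

lemma rotations_distribution:
  "rotations n (distribution f X) = distribution (\<lambda>(x, k). rotated n k (f x)) (X \<times> {1..n})"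
  by (simp only: rotations_def distribution_Times)

lemma rotated_cyc:
  assumes "k \<in> {1..n}"
  shows "rotated n (cyc n k) D = cyc n ` rotated n k D"
proof -
  have "cyc n ^^ cyc n k = cyc n \<circ> cyc n ^^ k"
    using assms cyc_funpow_eq_id[of n] by (cases "k = n") (simp_all add: cyc_def)
  then show ?thesis by (simp add: rotated_def image_comp)
qed

lemma mem_rotated: "k \<in> {1..n} \<Longrightarrow> k \<in> rotated n k D"
  by (simp add: rotated_def cyc_funpow_apply_top)

lemma rotated_nontrivial:
  assumes k: "k \<in> {1..n}" and D: "D \<subset> {1..n-1}"
  shows "rotated n k D \<noteq> {}" "rotated n k D \<subseteq> {1..n}" "rotated n k D \<noteq> {1..n}"
proof -
  show "rotated n k D \<noteq> {}" using mem_rotated[OF k] by auto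
  note perm = cyc_funpow_permutes[of n k]
  obtain i where "i \<in> {1..n-1} - D" using D by blast
  then have "i \<in> {1..n}" "i \<notin> insert n D" by auto
  moreover have "insert n D \<subseteq> {1..n}" using k D by force
  ultimately have "insert n D \<subset> {1..n}" by blast
  moreover have "(cyc n ^^ k) ` {1..n} = {1..n}" using perm k by (simp add: permutes_image)
  moreover have "inj (cyc n ^^ k)" using perm k by (simp add: permutes_inj)
  ultimately show "rotated n k D \<subseteq> {1..n}" "rotated n k D \<noteq> {1..n}"
    unfolding rotated_def
    by (metis image_mono psubset_imp_subset, metis inj_image_eq_iff psubset_eq)
qed

lemma inj_on_comp_cyc_funpow:
  assumes A: "A \<subseteq> {s. s permutes {1..n-1}}"
  shows "inj_on (\<lambda>(s, k). s \<circ> cyc n ^^ (n - k)) (A \<times> {1..n})"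
proof (rule inj_onI, clarify)
  fix s k t l
  assume st: "s \<in> A" "t \<in> A" and kl: "k \<in> {1..n}" "l \<in> {1..n}"
    and eq: "s \<circ> cyc n ^^ (n - k) = t \<circ> cyc n ^^ (n - l)"
  have n: "n \<ge> 1" using kl by simp
  have perm: "s permutes {1..n-1}" "t permutes {1..n-1}" using A st by auto
  have fixed: "s n = n" "t n = n" using permutes_not_in[OF perm(1)] permutes_not_in[OF perm(2)] n
    by auto
  have "t ((cyc n ^^ (n - l)) k) = t n"
    using fun_cong[OF eq, of k] cyc_funpow_diff_apply[OF kl(1)] fixed by simp
  then have "(cyc n ^^ (n - l)) k = (cyc n ^^ (n - l)) l"
    using cyc_funpow_diff_apply[OF kl(2)] permutes_inj[OF perm(2)] by (metis injD)
  then have "k = l" using permutes_inj[OF cyc_funpow_permutes[OF n]] by (metis injD)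
  moreover have "s = t"
    using eq \<open>k = l\<close> permutes_surj[OF cyc_funpow_permutes[OF n]] by (metis surj_fun_eq)
  ultimately show "s = t \<and> k = l" by simp
qed

proposition distribution_cdes_cyclic_group:
  assumes n: "n \<ge> 2" and A: "A \<subseteq> {s. s permutes {1..n-1}}"
  shows "distribution (cdes n) {s \<circ> c | s c. s \<in> A \<and> c \<in> cyclic_group n} =
    rotations n (distribution (des (n - 1)) A)"
proof -
  let ?f = "\<lambda>(s, k). s \<circ> cyc n ^^ (n - k)"
  have cdes: "cdes n (?f (s, k)) = rotated n k (des (n - 1) s)" if "s \<in> A" "k \<in> {1..n}" for s k
  proof -
    have "?f (s, k) \<circ> cyc n ^^ k = s"
      using that n by (simp add: comp_assoc cyc_funpow_diff_comp)
    moreover have "s permutes {1..n-1}" using A that by blast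
    ultimately show ?thesis
      using image_cdes_comp_cyc_funpow[where n = n and k = k and p = "?f (s, k)"]
        cdes_eq_insert_des[OF n, of s]
      by (simp only: rotated_def)
  qed
  have "{s \<circ> c | s c. s \<in> A \<and> c \<in> cyclic_group n} = ?f ` (A \<times> {1..n})"
    using n by (auto simp: cyclic_group_eq image_iff Bex_def) blast+
  then have "distribution (cdes n) {s \<circ> c | s c. s \<in> A \<and> c \<in> cyclic_group n} =
      distribution (\<lambda>x. cdes n (?f x)) (A \<times> {1..n})"
    using distribution_comp_bij_betw[OF inj_on_imp_bij_betw[OF inj_on_comp_cyc_funpow[OF A]],
      of "cdes n"]
    by (simp only:)
  also have "\<dots> = distribution (\<lambda>(s, k). rotated n k (des (n - 1) s)) (A \<times> {1..n})"
    using cdes by (intro distribution_cong) auto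
  finally show ?thesis by (simp only: rotations_distribution)
qed

section \<open>Blocks and rotated words\<close>

context
  fixes n :: nat and F :: "nat set"
  assumes F: "F \<subseteq> {1..n}" and top: "n \<in> F"
begin

private lemma finF: "finite F"
  using F by (rule finite_subset) simp

private lemma n_ge_1: "n \<ge> 1"
  using F top by auto

lemma block_1: "block F 1 = 1"
  using F by (auto simp: block_def)

lemma block_top: "block F n = card F"
proof -
  have "{e \<in> F. e < n} = F - {n}" using F by force
  then show ?thesis using card.remove[OF finF top] by (simp add: block_def)
qed

lemma block_range: "i \<le> n \<Longrightarrow> block F i \<in> {1..card F}"
  using monoD[OF mono_block[OF finF], of i n] block_top by (simp add: block_def)

lemma bij_betw_block: "bij_betw (block F) F {1..card F}"
proof -
  have block_less: "block F i < block F j" if "i \<in> F" "i < j" for i j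
  proof -
    have "block F i < block F (Suc i)" using that finF by (simp add: block_Suc)
    also have "\<dots> \<le> block F j" using that by (intro monoD[OF mono_block[OF finF]]) simp
    finally show ?thesis .
  qed
  have "inj_on (block F) F"
    by (rule inj_onI) (metis block_less less_irrefl linorder_neqE_nat)
  moreover have "block F ` F \<subseteq> {1..card F}"
    using block_range F by fastforce
  ultimately show ?thesis by (simp add: bij_betw_def card_image card_subset_eq)
qed

lemma block_image: "block F ` {1..n} = {1..card F}"
proof
  show "block F ` {1..n} \<subseteq> {1..card F}"
    using block_range by fastforce
  show "{1..card F} \<subseteq> block F ` {1..n}"
    using image_mono[OF F, of "block F"] bij_betw_block by (simp add: bij_betw_def)
qed

lemma block_cyc:
  assumes j: "j \<in> {1..n}"
  shows "block F (cyc n j) = (if j \<in> F then cyc (card F) (block F j) else block F j)"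
proof (cases "j = n")
  case True
  then show ?thesis using top block_1 by (simp add: cyc_top block_top)
next
  case False
  then have Suc: "cyc n j = Suc j" using j by (simp add: cyc_less)
  show ?thesis
  proof (cases "j \<in> F")
    case True
    then have "Suc (block F j) \<le> card F"
      using False j block_range[of "Suc j"] finF by (simp add: block_Suc)
    moreover have "1 \<le> block F j" using j block_range[of j] by simp
    ultimately have "cyc (card F) (block F j) = Suc (block F j)" by (simp add: cyc_less)
    then show ?thesis using True Suc finF by (simp add: block_Suc)
  qed (use Suc finF in \<open>simp add: block_Suc\<close>)
qed

context
  fixes k :: nat
  assumes k: "k \<in> F"
begin

private definition relabel :: "nat \<Rightarrow> nat" where
  "relabel = cyc (card F) ^^ (card F - block F k)"

text \<open>The blocks met by the cyclic walk \<open>k + 1, k + 2, \<dots>\<close>, relabelled so that the block of \<open>k\<close>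
  comes last.\<close>

definition rotated_word :: "nat \<Rightarrow> nat" where
  "rotated_word i = relabel (block F ((cyc n ^^ k) i))"

private lemma k_range: "k \<in> {1..n}" "block F k \<in> {1..card F}" and card_ge_1: "card F \<ge> 1"
  using k F bij_betwE[OF bij_betw_block] by auto

private lemma relabel_permutes: "relabel permutes {1..card F}"
  unfolding relabel_def by (rule cyc_funpow_permutes[OF card_ge_1])

lemma rotated_word_Suc:
  assumes i: "i \<in> {1..<n}"
  shows "rotated_word (Suc i) =
    (if (cyc n ^^ k) i \<in> F then Suc (rotated_word i) else rotated_word i)"
proof -
  let ?j = "(cyc n ^^ k) i"
  note perm = cyc_funpow_permutes[OF n_ge_1, of k]
  have j_range: "?j \<in> {1..n}" using i permutes_in_image[OF perm] by simp
  have "(cyc n ^^ k) n = k" using k_range by (simp add: cyc_funpow_apply_top)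
  then have "?j \<noteq> k" using i permutes_inj[OF perm] by (metis atLeastLessThan_iff injD less_irrefl)
  have "(cyc n ^^ k) (Suc i) = cyc n ?j" using i by (simp add: cyc_less funpow_swap1)
  then have "rotated_word (Suc i) =
      (if ?j \<in> F then cyc (card F) (rotated_word i) else rotated_word i)"
    unfolding rotated_word_def using block_cyc[OF j_range] by (simp add: relabel_def funpow_swap1)
  moreover have "cyc (card F) (rotated_word i) = Suc (rotated_word i)" if "?j \<in> F"
  proof (rule cyc_less)
    have "block F ?j \<noteq> block F k"
      using that k \<open>?j \<noteq> k\<close> bij_betw_block by (auto simp: bij_betw_def dest: inj_onD)
    then have "rotated_word i \<noteq> relabel (block F k)"
      unfolding rotated_word_def using permutes_inj[OF relabel_permutes] by (metis injD)
    moreover have "relabel (block F k) = card F"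
      unfolding relabel_def using k_range by (intro cyc_funpow_diff_apply)
    moreover have "rotated_word i \<in> {1..card F}"
      unfolding rotated_word_def
      using permutes_in_image[OF relabel_permutes] bij_betwE[OF bij_betw_block] that
      by blast
    ultimately show "1 \<le> rotated_word i" "rotated_word i < card F" by auto
  qed
  ultimately show ?thesis by simp
qed

lemma mono_on_rotated_word: "mono_on {1..n} rotated_word"
proof (rule mono_onI)
  fix i j assume "i \<in> {1..n}" "j \<in> {1..n}" "i \<le> j"
  show "rotated_word i \<le> rotated_word j"
    using \<open>i \<le> j\<close> \<open>j \<in> {1..n}\<close>
  proof (induction j rule: dec_induct)
    case (step j)
    then show ?case using \<open>i \<in> {1..n}\<close> rotated_word_Suc[of j] by auto
  qed simp
qed

lemma ascents_rotated_word: "i \<in> {1..<n} \<Longrightarrow> i \<in> ascents rotated_word \<longleftrightarrow> (cyc n ^^ k) i \<in> F"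
  by (simp add: ascents_def rotated_word_Suc)

lemma distribution_rotated_word:
  "distribution rotated_word {1..n-1} =
     image_mset relabel (distribution (block F) {1..n} - {#block F k#})"
proof -
  have perm: "(cyc n ^^ k) permutes {1..n}" by (rule cyc_funpow_permutes[OF n_ge_1])
  have "(cyc n ^^ k) ` ({1..n} - {n}) = {1..n} - {k}"
    using permutes_image[OF perm] permutes_inj[OF perm] k_range
    by (simp add: image_set_diff cyc_funpow_apply_top)
  moreover have "{1..n-1} = {1..n} - {n}" by auto
  ultimately have "bij_betw (cyc n ^^ k) {1..n-1} ({1..n} - {k})"
    using permutes_inj_on[OF perm] by (simp add: bij_betw_def)
  then have "distribution rotated_word {1..n-1} =
      distribution (\<lambda>i. relabel (block F i)) ({1..n} - {k})"
    unfolding rotated_word_def by (rule distribution_comp_bij_betw)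
  also have "\<dots> = image_mset relabel (distribution (block F) ({1..n} - {k}))"
    by (simp add: image_mset_distribution)
  also have "distribution (block F) ({1..n} - {k}) = distribution (block F) {1..n} - {#block F k#}"
    using k_range(1) by (simp add: distribution_def mset_set_Diff image_mset_Diff)
  finally show ?thesis .
qed

lemma kostka_rotated_word:
  assumes "skew_shape lam mu"
  shows "kostka lam mu (distribution rotated_word {1..n-1}) =
    kostka lam mu (distribution (block F) {1..n} - {#block F k#})"
  unfolding distribution_rotated_word
  using kostka_image_permutes[OF assms relabel_permutes] by simp

end

proposition card_rotated_subset:
  assumes shape: "skew_shape lam mu" and card: "n = Suc (card (cells lam mu))" and k: "k \<in> {1..n}"
  shows "card {S \<in> syt lam mu. rotated n k (syt_des lam mu S) \<subseteq> F} =
    (if k \<in> F then kostka lam mu (distribution (block F) {1..n} - {#block F k#}) else 0)"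
proof (cases "k \<in> F")
  case True
  have "rotated n k (syt_des lam mu S) \<subseteq> F \<longleftrightarrow> syt_des lam mu S \<subseteq> ascents (rotated_word k)" for S
  proof -
    have "syt_des lam mu S \<subseteq> {1..<n}" using syt_des_subset[of lam mu S] card by force
    then show ?thesis
      using ascents_rotated_word[OF True] True k
      by (auto simp: rotated_def cyc_funpow_apply_top subset_iff)
  qed
  moreover have "mono_on {1..card (cells lam mu)} (rotated_word k)"
    using mono_on_rotated_word[OF True] by (rule mono_on_subset) (simp add: card)
  ultimately show ?thesis
    using kostka_distribution_eq_card_syt[OF shape] kostka_rotated_word[OF True shape] card True
    by simp
next
  case False
  then have "\<not> rotated n k D \<subseteq> F" for D using mem_rotated[OF k] by blast
  then show ?thesis using False by simp
qed

end

section \<open>Adding a disconnected cell\<close>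

lemma part_Cons [simp]: "part (x # xs) 0 = x" "part (x # xs) (Suc r) = part xs r"
  by (auto simp: part_def)

lemma is_partition_Cons:
  assumes "is_partition xs" "0 < x" "part xs 0 \<le> x"
  shows "is_partition (x # xs)"
proof -
  have "y \<le> x" if mem: "y \<in> set xs" for y
  proof -
    obtain r where "r < length xs" "xs ! r = y" using mem by (auto simp: in_set_conv_nth)
    then have "y = part xs r" by (simp add: part_def)
    then show ?thesis using part_antimono[OF assms(1), of 0 r] assms(3) by simp
  qed
  then show ?thesis using assms(1,2) by (simp add: is_partition_def)
qed

text \<open>\<open>box_outer lam / box_inner lam mu\<close> is \<open>lam / mu\<close> shifted down by one row, with a new
  cell \<open>(0, part lam 0)\<close> to the upper right.\<close>

definition box_outer :: "nat list \<Rightarrow> nat list" where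
  "box_outer lam = Suc (part lam 0) # lam"

definition box_inner :: "nat list \<Rightarrow> nat list \<Rightarrow> nat list" where
  "box_inner lam mu = part lam 0 # mu"

definition add_box :: "nat list \<Rightarrow> nat \<Rightarrow> (nat \<times> nat \<Rightarrow> nat) \<Rightarrow> nat \<times> nat \<Rightarrow> nat" where
  "add_box lam v U x = (case fst x of 0 \<Rightarrow> if snd x = part lam 0 then v else 0
     | Suc r \<Rightarrow> U (r, snd x))"

definition remove_box :: "(nat \<times> nat \<Rightarrow> nat) \<Rightarrow> nat \<times> nat \<Rightarrow> nat" where
  "remove_box T x = T (Suc (fst x), snd x)"

lemma mem_cells_box [simp]:
  "(0, c) \<in> cells (box_outer lam) (box_inner lam mu) \<longleftrightarrow> c = part lam 0"
  "(Suc r, c) \<in> cells (box_outer lam) (box_inner lam mu) \<longleftrightarrow> (r, c) \<in> cells lam mu"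
  by (auto simp: mem_cells_iff box_outer_def box_inner_def)

lemma cells_box_eq:
  "cells (box_outer lam) (box_inner lam mu) =
     insert (0, part lam 0) ((\<lambda>x. (Suc (fst x), snd x)) ` cells lam mu)"
proof (intro set_eqI)
  fix x :: "nat \<times> nat"
  obtain r c where "x = (r, c)" by (cases x)
  then show "x \<in> cells (box_outer lam) (box_inner lam mu) \<longleftrightarrow>
      x \<in> insert (0, part lam 0) ((\<lambda>x. (Suc (fst x), snd x)) ` cells lam mu)"
    by (cases r) (force simp: image_iff)+
qed

lemma distribution_cells_box:
  "distribution T (cells (box_outer lam) (box_inner lam mu)) =
     add_mset (T (0, part lam 0)) (distribution (remove_box T) (cells lam mu))"
proof -
  have "inj_on (\<lambda>x. (Suc (fst x), snd x)) (cells lam mu)"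
    by (auto simp: inj_on_def prod_eq_iff)
  then show ?thesis
    unfolding distribution_eq_sum cells_box_eq
    by (subst sum.insert) (auto simp: sum.reindex remove_box_def)
qed

lemma card_cells_box: "card (cells (box_outer lam) (box_inner lam mu)) = Suc (card (cells lam mu))"
  using arg_cong[OF distribution_cells_box, of size] by (simp add: distribution_def)

lemma remove_add_box [simp]:
  "remove_box (add_box lam v U) = U" "add_box lam v U (0, part lam 0) = v"
  by (auto simp: fun_eq_iff remove_box_def add_box_def)

lemma add_remove_box:
  assumes "\<And>c. c \<noteq> part lam 0 \<Longrightarrow> T (0, c) = 0"
  shows "add_box lam (T (0, part lam 0)) (remove_box T) = T"
proof
  fix x
  show "add_box lam (T (0, part lam 0)) (remove_box T) x = T x"
    using assms by (cases x; cases "fst x") (auto simp: add_box_def remove_box_def)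
qed

lemma semistandard_box_iff:
  "semistandard (box_outer lam) (box_inner lam mu) T \<longleftrightarrow>
     (\<forall>c. c \<noteq> part lam 0 \<longrightarrow> T (0, c) = 0) \<and> semistandard lam mu (remove_box T)"
proof
  assume T: "semistandard (box_outer lam) (box_inner lam mu) T"
  then have zero: "x \<notin> cells (box_outer lam) (box_inner lam mu) \<Longrightarrow> T x = 0" for x
    unfolding semistandard_def by blast
  have "T (0, c) = 0" if "c \<noteq> part lam 0" for c using zero[of "(0, c)"] that by simp
  moreover have "remove_box T x = 0" if "x \<notin> cells lam mu" for x
    using zero[of "(Suc (fst x), snd x)"] that by (simp add: remove_box_def)
  ultimately show "(\<forall>c. c \<noteq> part lam 0 \<longrightarrow> T (0, c) = 0) \<and> semistandard lam mu (remove_box T)"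
    using T by (auto simp: semistandard_def remove_box_def)
next
  assume T: "(\<forall>c. c \<noteq> part lam 0 \<longrightarrow> T (0, c) = 0) \<and> semistandard lam mu (remove_box T)"
  then have outside: "x \<notin> cells lam mu \<Longrightarrow> T (Suc (fst x), snd x) = 0"
    and row: "(r, c) \<in> cells lam mu \<Longrightarrow> (r, c + 1) \<in> cells lam mu \<Longrightarrow> T (Suc r, c) \<le> T (Suc r, c + 1)"
    and column: "(r, c) \<in> cells lam mu \<Longrightarrow> (r + 1, c) \<in> cells lam mu \<Longrightarrow>
      T (Suc r, c) < T (Suc r + 1, c)"
    for x r c by (auto simp: semistandard_def remove_box_def)
  show "semistandard (box_outer lam) (box_inner lam mu) T"
    unfolding semistandard_def
  proof (intro conjI allI impI)
    fix x assume "x \<notin> cells (box_outer lam) (box_inner lam mu)"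
    then show "T x = 0" using T outside[of "(fst x - 1, snd x)"] by (cases x; cases "fst x") auto
  next
    fix r c assume "(r, c) \<in> cells (box_outer lam) (box_inner lam mu) \<and>
      (r, c + 1) \<in> cells (box_outer lam) (box_inner lam mu)"
    then show "T (r, c) \<le> T (r, c + 1)" using row by (cases r) auto
  next
    fix r c assume "(r, c) \<in> cells (box_outer lam) (box_inner lam mu) \<and>
      (r + 1, c) \<in> cells (box_outer lam) (box_inner lam mu)"
    then show "T (r, c) < T (r + 1, c)" using column
      by (cases r) (auto simp: mem_cells_iff[of _ _ lam mu])
  qed
qed

lemma finite_ssyt: "finite (ssyt lam mu (count M))"
proof (rule finite_subset)
  show "ssyt lam mu (count M) \<subseteq> {T. \<forall>x. (x \<in> cells lam mu \<longrightarrow> T x \<in> set_mset M) \<and>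
      (x \<notin> cells lam mu \<longrightarrow> T x = 0)}"
    by (auto simp: ssyt_iff semistandard_def count_inject set_mset_distribution)
qed (intro finite_set_of_finite_funs finite_cells finite_set_mset)

proposition kostka_box:
  "kostka (box_outer lam) (box_inner lam mu) M = (\<Sum>v\<in>set_mset M. kostka lam mu (M - {#v#}))"
proof -
  let ?pairs = "SIGMA v:set_mset M. ssyt lam mu (count (M - {#v#}))"
  let ?tableaux = "ssyt (box_outer lam) (box_inner lam mu) (count M)"
  have "bij_betw (\<lambda>(v, U). add_box lam v U) ?pairs ?tableaux"
  proof (rule bij_betw_byWitness[where f' = "\<lambda>T. (T (0, part lam 0), remove_box T)"])
    show "\<forall>T\<in>?tableaux. (case (T (0, part lam 0), remove_box T) of (v, U) \<Rightarrow> add_box lam v U) = T"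
      by (auto simp: ssyt_iff semistandard_box_iff intro: add_remove_box)
    show "(\<lambda>(v, U). add_box lam v U) ` ?pairs \<subseteq> ?tableaux"
    proof clarify
      fix v U assume "v \<in># M" "U \<in> ssyt lam mu (count (M - {#v#}))"
      then have "semistandard lam mu U" "add_mset v (distribution U (cells lam mu)) = M"
        by (auto simp: ssyt_iff count_inject)
      then show "add_box lam v U \<in> ?tableaux"
        by (auto simp: ssyt_iff semistandard_box_iff distribution_cells_box) (simp add: add_box_def)
    qed
    show "(\<lambda>T. (T (0, part lam 0), remove_box T)) ` ?tableaux \<subseteq> ?pairs"
      by (auto simp: ssyt_iff semistandard_box_iff distribution_cells_box count_inject)
  qed auto
  then have "card ?pairs = card ?tableaux" by (rule bij_betw_same_card)
  then show ?thesis by (simp add: kostka_def finite_ssyt)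
qed

context
  fixes lam mu :: "nat list"
  assumes shape: "skew_shape lam mu" and nonempty: "cells lam mu \<noteq> {}"
begin

private lemma part_0_pos: "0 < part lam 0"
proof -
  obtain r c where "(r, c) \<in> cells lam mu" using nonempty by auto
  then have "0 < part lam r" by (auto simp: mem_cells_iff)
  also have "\<dots> \<le> part lam 0" using shape by (intro part_antimono) (simp_all add: skew_shape_iff)
  finally show ?thesis .
qed

lemma skew_shape_box: "skew_shape (box_outer lam) (box_inner lam mu)"
proof -
  have "part mu r \<le> part lam r" "is_partition lam" "is_partition mu" for r
    using shape by (auto simp: skew_shape_iff)
  then have "is_partition (box_outer lam)" "is_partition (box_inner lam mu)"
    unfolding box_outer_def box_inner_def using part_0_pos by (auto intro!: is_partition_Cons)
  moreover have "part (box_inner lam mu) r \<le> part (box_outer lam) r" for r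
    using shape by (cases r) (auto simp: skew_shape_iff box_outer_def box_inner_def)
  ultimately show ?thesis by (simp add: skew_shape_iff)
qed

lemma not_connected_ribbon_box: "\<not> connected_ribbon (box_outer lam) (box_inner lam mu)"
proof
  let ?C = "cells (box_outer lam) (box_inner lam mu)"
  assume "connected_ribbon (box_outer lam) (box_inner lam mu)"
  moreover obtain r c where "(r, c) \<in> cells lam mu" using nonempty by auto
  then have "(0, part lam 0) \<in> ?C" "(Suc r, c) \<in> ?C" by simp_all
  ultimately have "((0, part lam 0), (Suc r, c)) \<in> (cell_adj ?C)\<^sup>*"
    unfolding connected_ribbon_def Let_def by blast
  then obtain y where y: "((0, part lam 0), y) \<in> cell_adj ?C"
    by (metis converse_rtranclE fst_conv old.nat.distinct(1))
  obtain r' c' where "y = (r', c')" by (cases y)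
  then show False using y by (cases r') (auto simp: cell_adj_def mem_cells_iff[of _ _ lam mu])
qed

end

section \<open>Existence of the cyclic descent extension\<close>

definition cyclic_descent_map ::
    "nat \<Rightarrow> nat list \<Rightarrow> nat list \<Rightarrow> ((nat \<times> nat \<Rightarrow> nat) \<Rightarrow> nat set) \<Rightarrow> bool" where
  "cyclic_descent_map n lam mu cD \<longleftrightarrow> skew_shape lam mu \<and> card (cells lam mu) = n \<and>
     \<not> connected_ribbon lam mu \<and> (\<exists>psi. cyclic_descent_ext lam mu cD psi)"

lemma cyclic_descent_ext_transport:
  assumes fin: "finite X" and nxt: "bij_betw nxt X X"
    and step: "\<And>x. x \<in> X \<Longrightarrow> g (nxt x) = shift1 (card (cells lam mu)) (g x)"
    and range: "\<And>x. x \<in> X \<Longrightarrow> g x \<subseteq> {1..card (cells lam mu)}"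
    and nontrivial: "\<And>x. x \<in> X \<Longrightarrow> g x \<noteq> {}" "\<And>x. x \<in> X \<Longrightarrow> g x \<noteq> {1..card (cells lam mu)}"
    and des: "distribution (\<lambda>x. g x \<inter> {1..card (cells lam mu) - 1}) X =
      distribution (syt_des lam mu) (syt lam mu)"
  shows "\<exists>cD. (\<exists>psi. cyclic_descent_ext lam mu cD psi) \<and>
    distribution cD (syt lam mu) = distribution g X"
proof -
  let ?Y = "syt lam mu" and ?n = "card (cells lam mu)"
  obtain b where b: "bij_betw b ?Y X"
    and g_b: "\<And>T. T \<in> ?Y \<Longrightarrow> g (b T) \<inter> {1..?n - 1} = syt_des lam mu T"
    using distribution_eq_obtain_bij_betw[OF fin finite_syt des] by metis
  define cD where "cD T = g (b T)" for T
  define psi where "psi = inv_into ?Y b \<circ> (nxt \<circ> b)"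
  have b_in: "b T \<in> X" if "T \<in> ?Y" for T using bij_betwE[OF b] that by blast
  have b_psi: "b (psi T) = nxt (b T)" if "T \<in> ?Y" for T
    using bij_betw_inv_into_right[OF b] bij_betwE[OF nxt] b_in[OF that] by (simp add: psi_def)
  have "bij_betw psi ?Y ?Y"
    unfolding psi_def
    by (rule bij_betw_trans[OF bij_betw_trans[OF b nxt] bij_betw_inv_into[OF b]])
  moreover have "cD (psi T) = shift1 ?n (cD T)" if "T \<in> ?Y" for T
    using step[OF b_in[OF that]] by (simp add: cD_def b_psi[OF that])
  ultimately have "cyclic_descent_ext lam mu cD psi"
    using range[OF b_in] nontrivial[OF b_in] g_b
    by (simp add: cyclic_descent_ext_def Let_def cD_def)
  moreover have "distribution cD ?Y = distribution g X"
    unfolding cD_def using b by (rule distribution_comp_bij_betw)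
  ultimately show ?thesis by blast
qed

context
  fixes lam mu :: "nat list" and n :: nat
  assumes shape: "skew_shape lam mu" and nonempty: "cells lam mu \<noteq> {}"
    and n: "n = Suc (card (cells lam mu))"
begin

private abbreviation "outer \<equiv> box_outer lam"
private abbreviation "inner \<equiv> box_inner lam mu"

lemma sum_card_rotated_subset:
  assumes F: "F \<subseteq> {1..n}" "n \<in> F"
  shows "(\<Sum>k=1..n. card {S \<in> syt lam mu. rotated n k (syt_des lam mu S) \<subseteq> F}) =
    card {T \<in> syt outer inner. syt_des outer inner T \<subseteq> F}"
proof -
  let ?M = "distribution (block F) {1..n}"
  have finF: "finite F" using F(1) by (rule finite_subset) simp
  have "(\<Sum>k=1..n. card {S \<in> syt lam mu. rotated n k (syt_des lam mu S) \<subseteq> F}) =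
      (\<Sum>k=1..n. if k \<in> F then kostka lam mu (?M - {#block F k#}) else 0)"
    using card_rotated_subset[OF F shape n] by (intro sum.cong) auto
  also have "\<dots> = (\<Sum>k\<in>F. kostka lam mu (?M - {#block F k#}))"
    using F(1) by (simp add: Int_absorb1 flip: sum.inter_restrict)
  also have "\<dots> = (\<Sum>v\<in>{1..card F}. kostka lam mu (?M - {#v#}))"
    by (rule sum.reindex_bij_betw[OF bij_betw_block[OF F]])
  also have "\<dots> = kostka outer inner ?M"
    by (simp only: kostka_box set_mset_distribution finite_atLeastAtMost block_image[OF F])
  also have "\<dots> = card {T \<in> syt outer inner. syt_des outer inner T \<subseteq> F}"
    using kostka_distribution_eq_card_syt[OF skew_shape_box[OF shape nonempty], of "block F"]
      mono_on_subset[OF mono_block[OF finF]] by (simp add: card_cells_box n ascents_block[OF finF])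
  finally show ?thesis .
qed

lemma rotated_syt_des_nontrivial:
  assumes k: "k \<in> {1..n}"
  shows "rotated n k (syt_des lam mu S) \<subseteq> {1..n}" "rotated n k (syt_des lam mu S) \<noteq> {}"
    "rotated n k (syt_des lam mu S) \<noteq> {1..n}"
proof -
  have "card (cells lam mu) > 0" using nonempty by (simp add: card_gt_0_iff)
  then have "n - 1 \<in> {1..n-1}" "n - 1 \<notin> syt_des lam mu S"
    using syt_des_subset[of lam mu S] n by auto
  moreover have "syt_des lam mu S \<subseteq> {1..n-1}" using syt_des_subset[of lam mu S] n by force
  ultimately have "syt_des lam mu S \<subset> {1..n-1}" by blast
  from rotated_nontrivial[OF k this] show "rotated n k (syt_des lam mu S) \<subseteq> {1..n}"
    "rotated n k (syt_des lam mu S) \<noteq> {}" "rotated n k (syt_des lam mu S) \<noteq> {1..n}" by auto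
qed

lemma distribution_rotated_syt_des:
  "distribution (\<lambda>(S, k). rotated n k (syt_des lam mu S) \<inter> {1..n-1}) (syt lam mu \<times> {1..n}) =
   distribution (syt_des outer inner) (syt outer inner)"
proof (rule multiset_eqI_size_subsets[where U = "{1..n-1}"])
  let ?restricted =
    "distribution (\<lambda>(S, k). rotated n k (syt_des lam mu S) \<inter> {1..n-1}) (syt lam mu \<times> {1..n})"
  have des_subset: "syt_des outer inner T \<subseteq> {1..n-1}" for T
    using syt_des_subset[of outer inner T] by (simp add: card_cells_box n)
  then show "D \<in># distribution (syt_des outer inner) (syt outer inner) \<Longrightarrow> D \<subseteq> {1..n-1}" for D
    by (auto simp: set_mset_distribution)
  fix E assume E: "E \<subseteq> {1..n-1}"
  let ?F = "insert n E"
  have F: "?F \<subseteq> {1..n}" "n \<in> ?F" using E n by auto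
  have interval: "{1..n} = insert n {1..n-1}" "n \<notin> {1..n-1}" using n by auto
  have restrict_iff: "rotated n k (syt_des lam mu S) \<inter> {1..n-1} \<subseteq> E \<longleftrightarrow>
      rotated n k (syt_des lam mu S) \<subseteq> ?F"
    if "k \<in> {1..n}" for S k
  proof -
    have "rotated n k (syt_des lam mu S) \<subseteq> insert n {1..n-1}"
      using rotated_syt_des_nontrivial(1)[OF that] by (simp only: interval(1))
    then show ?thesis using E interval(2) by blast
  qed
  have "size {#D \<in># ?restricted. D \<subseteq> E#} =
      (\<Sum>k=1..n. card {S \<in> syt lam mu. rotated n k (syt_des lam mu S) \<inter> {1..n-1} \<subseteq> E})"
    by (simp only: distribution_Times[where h = "\<lambda>k D. rotated n k D \<inter> {1..n-1}"]
        size_filter_sum_mset image_mset_distribution size_filter_distribution finite_syt)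
  also have "\<dots> = (\<Sum>k=1..n. card {S \<in> syt lam mu. rotated n k (syt_des lam mu S) \<subseteq> ?F})"
    by (intro sum.cong refl arg_cong[where f = card] Collect_cong) (simp only: restrict_iff)
  also have "\<dots> = card {T \<in> syt outer inner. syt_des outer inner T \<subseteq> ?F}"
    by (rule sum_card_rotated_subset[OF F])
  also have "\<dots> = card {T \<in> syt outer inner. syt_des outer inner T \<subseteq> E}"
  proof -
    have "syt_des outer inner T \<subseteq> ?F \<longleftrightarrow> syt_des outer inner T \<subseteq> E" for T
      using des_subset[of T] interval(2) by blast
    then show ?thesis by simp
  qed
  finally show "size {#D \<in># ?restricted. D \<subseteq> E#} =
      size {#D \<in># distribution (syt_des outer inner) (syt outer inner). D \<subseteq> E#}"
    by (simp add: size_filter_distribution)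
qed (auto simp: set_mset_distribution)

proposition cyclic_descent_map_box:
  "\<exists>cD. cyclic_descent_map n outer inner cD \<and>
    distribution cD (syt outer inner) = rotations n (distribution (syt_des lam mu) (syt lam mu))"
proof -
  let ?X = "syt lam mu \<times> {1..n}" and ?g = "\<lambda>(S, k). rotated n k (syt_des lam mu S)"
  have card: "card (cells outer inner) = n" by (simp add: card_cells_box n)
  have "\<exists>cD. (\<exists>psi. cyclic_descent_ext outer inner cD psi) \<and>
      distribution cD (syt outer inner) = distribution ?g ?X"
  proof (rule cyclic_descent_ext_transport[where nxt = "map_prod id (cyc n)"], unfold card)
    show "finite ?X" by simp
    show "bij_betw (map_prod id (cyc n)) ?X ?X"
      using permutes_imp_bij[OF cyc_permutes[of n]] n by (intro bij_betw_map_prod) auto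
    show "distribution (\<lambda>x. ?g x \<inter> {1..n-1}) ?X =
        distribution (syt_des outer inner) (syt outer inner)"
      using distribution_rotated_syt_des by (simp add: case_prod_unfold)
    fix x assume "x \<in> ?X"
    then obtain S k where x: "x = (S, k)" and k: "k \<in> {1..n}" by auto
    show "?g x \<subseteq> {1..n}" "?g x \<noteq> {}" "?g x \<noteq> {1..n}"
      using rotated_syt_des_nontrivial[OF k] by (simp_all add: x)
    then show "?g (map_prod id (cyc n) x) = shift1 n (?g x)"
      using rotated_cyc[OF k] by (simp add: x shift1_eq_cyc_image)
  qed
  then show ?thesis
    using skew_shape_box[OF shape nonempty] not_connected_ribbon_box[OF shape nonempty] card
    by (simp add: cyclic_descent_map_def rotations_distribution)
qed

end

section \<open>Cyclic Schur-positivity\<close>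

lemma rotations_sum_repeat_mset:
  "rotations n (\<Sum>i\<in>I. repeat_mset (k i) (M i)) = (\<Sum>i\<in>I. repeat_mset (k i) (rotations n (M i)))"
proof -
  have add: "rotations n (L + M) = rotations n L + rotations n M" for L M
    by (simp add: rotations_def sum.distrib)
  have empty: "rotations n {#} = {#}" by (simp add: rotations_def)
  have "rotations n (repeat_mset j M) = repeat_mset j (rotations n M)" for j M
    by (induction j) (simp_all add: add empty)
  then show ?thesis
    by (induction I rule: infinite_finite_induct) (simp_all add: add empty)
qed

lemma cyclic_schur_positiveI:
  assumes fin: "finite A" "finite I" and inj: "inj_on shape I"
    and cdes: "distribution (cdes n) A = (\<Sum>i\<in>I. repeat_mset (k i) (M i))"
    and maps: "\<And>i. i \<in> I \<Longrightarrow> \<exists>cD. cyclic_descent_map n (fst (shape i)) (snd (shape i)) cD \<and>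
      distribution cD (syt (fst (shape i)) (snd (shape i))) = M i"
  shows "cyclic_schur_positive n A"
proof -
  define index where "index = inv_into I shape"
  define m where "m s = (if s \<in> shape ` I then k (index s) else 0)" for s
  have index: "index (shape i) = i" if "i \<in> I" for i
    using that inj by (simp add: index_def)
  have supp: "{s. m s \<noteq> 0} \<subseteq> shape ` I" by (auto simp: m_def)
  have "\<forall>s\<in>shape ` I. \<exists>cD. cyclic_descent_map n (fst s) (snd s) cD \<and>
      distribution cD (syt (fst s) (snd s)) = M (index s)"
    using maps index by simp
  from bchoice[OF this] obtain cD
    where map: "\<And>s. s \<in> shape ` I \<Longrightarrow> cyclic_descent_map n (fst s) (snd s) (cD s)"
      and distr: "\<And>s. s \<in> shape ` I \<Longrightarrow> distribution (cD s) (syt (fst s) (snd s)) = M (index s)"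
    by blast
  have "card {p \<in> A. cdes n p = J} =
      (\<Sum>s\<in>{s. m s \<noteq> 0}. m s * card {T \<in> syt (fst s) (snd s). cD s T = J})" for J
  proof -
    have "card {p \<in> A. cdes n p = J} = (\<Sum>i\<in>I. k i * count (M i) J)"
      using arg_cong[OF cdes, of "\<lambda>L. count L J"] fin(1) by (simp add: count_distribution count_sum)
    also have "\<dots> = (\<Sum>s\<in>shape ` I. m s * count (M (index s)) J)"
      by (simp add: sum.reindex[OF inj] m_def index)
    also have "\<dots> = (\<Sum>s\<in>shape ` I. m s * card {T \<in> syt (fst s) (snd s). cD s T = J})"
      by (intro sum.cong) (simp_all add: count_distribution flip: distr)
    also have "\<dots> = (\<Sum>s\<in>{s. m s \<noteq> 0}. m s * card {T \<in> syt (fst s) (snd s). cD s T = J})"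
      using fin(2) supp by (intro sum.mono_neutral_right) auto
    finally show ?thesis .
  qed
  moreover have "finite {s. m s \<noteq> 0}" using supp fin(2) by (auto intro: finite_subset)
  moreover have "cyclic_descent_map n (fst s) (snd s) (cD s)" if "m s \<noteq> 0" for s
    using map supp that by blast
  ultimately show ?thesis
    unfolding cyclic_schur_positive_def cyclic_descent_map_def
    by (intro exI[of _ m] exI[of _ cD] conjI allI impI) blast+
qed

theorem theorem3p11:
  fixes n :: nat and A :: "(nat \<Rightarrow> nat) set"
  assumes "n \<ge> 2"
    and "A \<subseteq> {s. s permutes {1..n-1}}"
    and "schur_positive (n-1) A"
  shows "cyclic_schur_positive n {s \<circ> c | s c. s \<in> A \<and> c \<in> cyclic_group n}"
proof -
  let ?AC = "{s \<circ> c | s c. s \<in> A \<and> c \<in> cyclic_group n}" and ?P = "partitions_of (n - 1)"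
  let ?des = "\<lambda>lam. distribution (syt_des lam []) (syt lam [])"
  let ?shape = "\<lambda>lam. (box_outer lam, box_inner lam [])"
  have finA: "finite A" using assms(2) by (rule finite_subset) (simp add: finite_permutations)
  obtain k where "distribution (des (n - 1)) A = (\<Sum>lam\<in>?P. repeat_mset (k lam) (?des lam))"
    using schur_positive_obtain_des_distribution[OF assms(3) finA] .
  then have cdes: "distribution (cdes n) ?AC =
      (\<Sum>lam\<in>?P. repeat_mset (k lam) (rotations n (?des lam)))"
    by (simp only: distribution_cdes_cyclic_group[OF assms(1,2)] rotations_sum_repeat_mset)
  have maps: "\<exists>cD. cyclic_descent_map n (box_outer lam) (box_inner lam []) cD \<and>
      distribution cD (syt (box_outer lam) (box_inner lam [])) = rotations n (?des lam)"
    if "lam \<in> ?P" for lam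
  proof (rule cyclic_descent_map_box)
    show "skew_shape lam []" "cells lam [] \<noteq> {}" "n = Suc (card (cells lam []))"
      using partitions_ofD[OF that] assms(1) by auto
  qed
  have "finite ?AC"
    using finA assms(1) by (intro finite_image_set2) (simp_all add: cyclic_group_eq)
  then show ?thesis
    using cdes maps finite_partitions_of
    by (intro cyclic_schur_positiveI[where shape = ?shape]) (simp_all add: inj_on_def box_outer_def)
qed

end
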